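(* As $n \to \infty$, \[ \nu_2(K_{7,n}) = \tfrac{9}{4}n^2 + O(n) = Z(7,n) + O(n), \qquad \nu_2(K_{8,n}) = 3n^2 + O(n) = Z(8,n) + O(n). \] Consequently, \[ \lim_{n\to\infty} \frac{\nu_2(K_{7,n})}{Z(7,n)} = 1 \quad\text{and}\quad \lim_{n\to\infty} \frac{\nu_2(K_{8,n})}{Z(8,n)} = 1 . \]
   Context: A $2$-page drawing of a graph places its vertices on a straight line (the spine), and draws each edge as a curve contained in one of the two open half-planes determined by the spine (edges meet the spine only at their endpoints). The $2$-page crossing number $\nu_2(G)$ of a graph $G$ is the minimum number of pairwise crossings of edges (at points other than vertices) over all $2$-page drawings of $G$. $K_{m,n}$ denotes the complete bipartite graph with parts of sizes $m$ and $n$, and \[ Z(m,n) := \left\lfloor \frac{n}{2}\right\rfloor \left\lfloor \frac{n-1}{2}\right\rfloor \left\lfloor \frac{m}{2}\right\rfloor \left\lfloor \frac{m-1}{2}\right\rfloor . \] *)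

theory Defs
  imports "HOL-Analysis.Analysis" "HOL-Library.Landau_Symbols"
begin

text \<open>Simple graphs: every edge is a two-element set of vertices.\<close>

record 'a graph =
  vertices :: "'a set"
  edges :: "'a set set"

definition complete_bipartite :: "nat \<Rightarrow> nat \<Rightarrow> (nat + nat) graph" where
  "complete_bipartite m n =
     \<lparr>vertices = {..<m} <+> {..<n},
      edges = {{Inl i, Inr j} | i j. i < m \<and> j < n}\<rparr>"

text \<open>The spine is an arbitrary line, given as the solution set of \<open>a \<bullet> x = b\<close> with normal
  vector \<open>a \<noteq> 0\<close>; its two open half-planes are \<open>a \<bullet> x < b\<close> and \<open>a \<bullet> x > b\<close>.\<close>

record 'a spine_drawing =
  normal :: "real ^ 2"
  offset :: real
  pos :: "'a \<Rightarrow> real ^ 2"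
  curve :: "'a set \<Rightarrow> real \<Rightarrow> real ^ 2"

definition spine :: "'a spine_drawing \<Rightarrow> (real ^ 2) set" where
  "spine D = {x. normal D \<bullet> x = offset D}"

definition lower_page :: "'a spine_drawing \<Rightarrow> (real ^ 2) set" where
  "lower_page D = {x. normal D \<bullet> x < offset D}"

definition upper_page :: "'a spine_drawing \<Rightarrow> (real ^ 2) set" where
  "upper_page D = {x. normal D \<bullet> x > offset D}"

definition two_page_drawing :: "'a graph \<Rightarrow> 'a spine_drawing \<Rightarrow> bool" where
  "two_page_drawing G D \<longleftrightarrow>
     normal D \<noteq> 0 \<and>
     inj_on (pos D) (vertices G) \<and>
     pos D ` vertices G \<subseteq> spine D \<and>
     (\<forall>e\<in>edges G.
        arc (curve D e) \<and>
        {pathstart (curve D e), pathfinish (curve D e)} = pos D ` e \<and>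
        (curve D e ` {0<..<1} \<subseteq> lower_page D \<or> curve D e ` {0<..<1} \<subseteq> upper_page D))"

text \<open>A crossing is a pair of distinct edges together with a common point that is not a vertex, so
  two edges meeting several times contribute several crossings, and a point shared by \<open>k\<close> edges
  contributes one crossing for each of the \<open>k choose 2\<close> pairs.\<close>

definition crossings :: "'a graph \<Rightarrow> 'a spine_drawing \<Rightarrow> ('a set set \<times> (real ^ 2)) set" where
  "crossings G D =
     {({e, f}, x) | e f x. e \<in> edges G \<and> f \<in> edges G \<and> e \<noteq> f \<and>
        x \<in> path_image (curve D e) \<inter> path_image (curve D f) - pos D ` vertices G}"

text \<open>Drawings with infinitely many crossings are excluded explicitly, because \<open>card\<close> maps infinite
  sets to \<open>0\<close>.\<close>

definition two_page_crossing_number :: "'a graph \<Rightarrow> nat" ("\<nu>\<^sub>2") where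
  "\<nu>\<^sub>2 G = (LEAST k. \<exists>D. two_page_drawing G D \<and> finite (crossings G D) \<and> card (crossings G D) = k)"

definition Z :: "nat \<Rightarrow> nat \<Rightarrow> int" where
  "Z m n = \<lfloor>real n / 2\<rfloor> * \<lfloor>(real n - 1) / 2\<rfloor> * \<lfloor>real m / 2\<rfloor> * \<lfloor>(real m - 1) / 2\<rfloor>"

end

theory Submission imports Defs begin

text \<open>
  In a 2-page drawing of \<open>K\<^bsub>7,n\<^esub>\<close>, each of the \<open>n\<close> red vertices has a type: the gap of the spine
  (among the 7 blue vertices, read cyclically) that contains it, and the pages of its 7 edges.
  Edges on the same page whose ends interlace on the spine must meet, so two types determine a lower
  bound \<open>Q\<close> for the number of crossings between two red vertices. It remains to see that
  \<open>\<Sum> Q \<ge> 9/4 n\<^sup>2 - O(n)\<close>, which is the statement that \<open>2Q - 9\<close> is, up to the diagonal, the sum of a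
  positive semidefinite and an entrywise nonnegative form on types. Such a decomposition is
  exhibited by an explicit integral certificate, invariant under the rotation of the gaps. The pages
  of the edges to the two blue neighbours of a red vertex only matter for pairs in the same gap, so
  the semidefinite form may be taken to depend only on the other five pages.

  The bound for \<open>K\<^bsub>8,n\<^esub>\<close> follows by deleting a blue vertex in all 8 ways: every crossing survives 6 of
  the deletions. The upper bounds come from a drawing in which the blue vertices form two arcs
  of sizes \<open>\<lfloor>m/2\<rfloor>\<close> and \<open>\<lceil>m/2\<rceil>\<close> separated by two groups of red vertices.
\<close>

section \<open>Circulant quadratic forms on lists\<close>

text \<open>The value 9/4 n^2 means that \<open>Q\<close> averages 9/2 over pairs of red vertices.
  No bound for a single pair can give this: in the optimal drawing two red vertices account for 9
  crossings if they are in the same group and for none otherwise. A semidefinite form absorbs such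
  pairs, because its sum over all ordered pairs, the diagonal included, is nonnegative; the n
  diagonal terms are bounded and cost O(n).

  Two symmetries keep the certificate small. Closing the spine to a circle identifies the two outer
  gaps and makes \<open>Q\<close> depend on the gaps only through their cyclic difference, so the
  matrices are block circulant. Exchanging the pages negates all colours and preserves
  \<open>Q\<close>, so the form splits into a part on features of even degree and one on features of
  odd degree.

  The numerical origin of the certificate is not trusted. Semidefiniteness of M is read off from s M
  = A A^T + R with R diagonally dominant, an exact integer check that tolerates a rounded factor A.
  The inequality between types is evaluated for all pairs up to symmetry, scaled by 351232 = 2^10
  7^3 to stay integral.\<close>

fun dot :: "int list \<Rightarrow> int list \<Rightarrow> int" where
  "dot (x # xs) (y # ys) = x * y + dot xs ys"
| "dot [] ys = 0"
| "dot xs [] = 0"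

definition mat_vec :: "int list list \<Rightarrow> int list \<Rightarrow> int list" where
  "mat_vec M v = map (\<lambda>r. dot r v) M"

text \<open>A feature vector consists of blocks of 7: one functional and its translates around the
  circle, evaluated at a red vertex in gap 0. Moving the red vertex to the next gap rotates all
  blocks at once. A functional that looks at a single gap fills one entry of its block; two nonzero
  entries mean that it couples two gaps.\<close>

fun rot7 :: "'a list \<Rightarrow> 'a list" where
  "rot7 (a # b # c # d # e # f # g # xs) = g # a # b # c # d # e # f # rot7 xs"
| "rot7 xs = xs"

text \<open>Indices are \<open>7 i + m\<close>; the entry at \<open>(7 i + m, 7 j + k)\<close> is entry \<open>(k - m) mod 7\<close> of block \<open>(i, j)\<close>.\<close>

definition circulant_rows :: "int list list \<Rightarrow> int list list" where
  "circulant_rows bs = map (\<lambda>m. concat (map (rotate (7 - m)) bs)) [0, 1, 2, 3, 4, 5, 6]"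

definition block_circulant :: "int list list list \<Rightarrow> int list list" where
  "block_circulant B = concat (map circulant_rows B)"

text \<open>Weighted absolute row sum of the remainder s M - A A^T, computed without forming the
  remainder as a matrix.\<close>

fun dominant_row :: "int \<Rightarrow> int list \<Rightarrow> int list list \<Rightarrow> int list \<Rightarrow> int list \<Rightarrow> int" where
  "dominant_row s a (b # bs) (x # xs) (t # ts) = \<bar>s * x - dot a b\<bar> * t + dominant_row s a bs xs ts"
| "dominant_row s a _ _ _ = 0"

text \<open>The row sums include the diagonal entry, so the factor 2 makes this the usual weighted
  dominance of the diagonal over the rest of the row.\<close>

fun dominant_from :: "nat \<Rightarrow> int \<Rightarrow> int list list \<Rightarrow> int list \<Rightarrow> int list list \<Rightarrow> int list list \<Rightarrow> bool" where
  "dominant_from i s bs ts (a # as) (x # xs) =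
     (dominant_row s a bs x ts \<le> 2 * (s * x ! i - dot a a) * ts ! i \<and>
      dominant_from (Suc i) s bs ts as xs)"
| "dominant_from i s bs ts _ _ = True"

section \<open>Semidefiniteness from an approximate factorisation\<close>

lemma dot_conv_sum: "dot xs ys = (\<Sum>k<min (length xs) (length ys). xs ! k * ys ! k)"
  by (induction xs ys rule: dot.induct) (simp_all add: sum.lessThan_Suc_shift del: sum.lessThan_Suc)

lemma dot_commute: "dot xs ys = dot ys xs"
  by (simp add: dot_conv_sum min.commute mult.commute)

lemma dot_mat_vec:
  assumes "length x = n" "length M = n" "length y = n" "\<forall>r\<in>set M. length r = n"
  shows "dot x (mat_vec M y) = (\<Sum>a<n. \<Sum>b<n. M ! a ! b * x ! a * y ! b)"
proof -
  have "dot x (mat_vec M y) = (\<Sum>a<n. x ! a * dot (M ! a) y)"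
    using assms by (simp add: dot_conv_sum[of x] mat_vec_def)
  also have "\<dots> = (\<Sum>a<n. \<Sum>b<n. M ! a ! b * x ! a * y ! b)"
    using assms by (intro sum.cong) (auto simp: dot_conv_sum sum_distrib_left algebra_simps)
  finally show ?thesis .
qed

lemma dominant_rowD:
  assumes "length bs = length xs" "length ts = length xs"
  shows "dominant_row s a bs xs ts = (\<Sum>j<length xs. \<bar>s * xs ! j - dot a (bs ! j)\<bar> * ts ! j)"
  using assms
proof (induction s a bs xs ts rule: dominant_row.induct)
  case (1 s a b bs x xs t ts)
  then show ?case by (simp add: sum.lessThan_Suc_shift del: sum.lessThan_Suc)
qed auto

lemma dominant_fromD:
  assumes "dominant_from k s bs ts as xs" "length as = length xs" "i < length xs"
  shows "dominant_row s (as ! i) bs (xs ! i) ts \<le> 2 * (s * xs ! i ! (k + i) - dot (as ! i) (as ! i)) * ts ! (k + i)"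
  using assms
proof (induction k s bs ts as xs arbitrary: i rule: dominant_from.induct)
  case (1 k s bs ts a as x xs)
  show ?case
  proof (cases i)
    case 0
    then show ?thesis using 1 by simp
  next
    case (Suc j)
    then show ?thesis using 1(1)[of j] 1(2-) by simp
  qed
qed auto

text \<open>Rescaling by the weights, \<open>x i = t i * z i\<close>, reduces to unit weights. Each
  off-diagonal product is then at most the mean of the two squares and is charged half to each of
  its rows.\<close>

lemma diagonally_dominant_nonneg:
  fixes R :: "nat \<Rightarrow> nat \<Rightarrow> real" and t x :: "nat \<Rightarrow> real"
  assumes sym: "\<And>i j. i < n \<Longrightarrow> j < n \<Longrightarrow> R i j = R j i"
    and pos: "\<And>i. i < n \<Longrightarrow> t i > 0"
    and dom: "\<And>i. i < n \<Longrightarrow> (\<Sum>j<n. \<bar>R i j\<bar> * t j) \<le> 2 * R i i * t i"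
  shows "0 \<le> (\<Sum>i<n. \<Sum>j<n. R i j * x i * x j)"
proof -
  define z where "z i = x i / t i" for i
  define h where "h i j = \<bar>R i j\<bar> * t i * t j" for i j
  have x: "x i = t i * z i" if "i < n" for i
    using pos[OF that] by (simp add: z_def)
  have diag: "0 \<le> R i i" if "i < n" for i
  proof -
    have "0 \<le> (\<Sum>j<n. \<bar>R i j\<bar> * t j)"
      by (intro sum_nonneg mult_nonneg_nonneg) (auto simp: pos less_imp_le)
    then have "0 \<le> 2 * R i i * t i" using dom[OF that] by linarith
    then show ?thesis using pos[OF that] by (simp add: zero_le_mult_iff)
  qed
  have "(\<Sum>i<n. \<Sum>j<n. h i j * ((z i)\<^sup>2 + (z j)\<^sup>2) / 2) = (\<Sum>i<n. \<Sum>j<n. h i j * (z i)\<^sup>2)"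
  proof -
    have "(\<Sum>i<n. \<Sum>j<n. h i j * (z j)\<^sup>2) = (\<Sum>i<n. \<Sum>j<n. h i j * (z i)\<^sup>2)"
      by (subst sum.swap) (intro sum.cong refl, auto simp: h_def sym)
    then show ?thesis
      by (simp add: sum_divide_distrib[symmetric] sum.distrib distrib_left)
  qed
  also have "\<dots> = (\<Sum>i<n. t i * (z i)\<^sup>2 * (\<Sum>j<n. \<bar>R i j\<bar> * t j))"
    by (simp add: h_def sum_distrib_left algebra_simps)
  also have "\<dots> \<le> (\<Sum>i<n. t i * (z i)\<^sup>2 * (2 * R i i * t i))"
    by (intro sum_mono mult_left_mono dom) (auto simp: pos less_imp_le)
  also have "\<dots> = (\<Sum>i<n. \<Sum>j<n. if i = j then 2 * R i i * (t i)\<^sup>2 * (z i)\<^sup>2 else 0)"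
    by (simp add: power2_eq_square algebra_simps)
  finally have le: "0 \<le> (\<Sum>i<n. \<Sum>j<n. (if i = j then 2 * R i i * (t i)\<^sup>2 * (z i)\<^sup>2 else 0) -
      h i j * ((z i)\<^sup>2 + (z j)\<^sup>2) / 2)"
    by (simp add: sum_subtractf)
  \<comment> \<open>Termwise: equality on the diagonal, because \<open>R i i\<close> is nonnegative,
    and the mean inequality elsewhere.\<close>
  also have "\<dots> \<le> (\<Sum>i<n. \<Sum>j<n. R i j * x i * x j)"
  proof (intro sum_mono)
    fix i j assume "i \<in> {..<n}" "j \<in> {..<n}"
    then have ij: "i < n" "j < n" by auto
    show "(if i = j then 2 * R i i * (t i)\<^sup>2 * (z i)\<^sup>2 else 0) - h i j * ((z i)\<^sup>2 + (z j)\<^sup>2) / 2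
        \<le> R i j * x i * x j"
    proof (cases "i = j")
      case True
      then show ?thesis using diag[OF ij(1)] x[OF ij(1)] by (simp add: h_def power2_eq_square)
    next
      case False
      have "0 \<le> h i j" using pos ij by (simp add: h_def less_imp_le)
      have "\<bar>z i * z j\<bar> \<le> ((z i)\<^sup>2 + (z j)\<^sup>2) / 2"
        using sum_squares_bound[of "\<bar>z i\<bar>" "\<bar>z j\<bar>"] by (simp add: abs_mult)
      then have "h i j * \<bar>z i * z j\<bar> \<le> h i j * (((z i)\<^sup>2 + (z j)\<^sup>2) / 2)"
        using \<open>0 \<le> h i j\<close> by (rule mult_left_mono)
      moreover have "\<bar>R i j * x i * x j\<bar> = h i j * \<bar>z i * z j\<bar>"
        using pos[OF ij(1)] pos[OF ij(2)] by (simp add: x[OF ij(1)] x[OF ij(2)] h_def abs_mult)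
      ultimately show ?thesis using False by (simp add: abs_le_iff)
    qed
  qed
  finally show ?thesis .
qed

lemma nth_nth_of_transpose:
  assumes "List.transpose M = M" "length M = n" "\<forall>r\<in>set M. length r = n" "i < n" "j < n"
  shows "M ! i ! j = M ! j ! i"
proof -
  have "filter (\<lambda>r. i < length r) M = M" using assms by (auto intro: filter_True)
  then have "M ! i = map (\<lambda>r. r ! i) M"
    using nth_transpose[of i M] assms by simp
  then show ?thesis using assms by (metis nth_map)
qed

lemma certified_nonneg:
  fixes x :: "nat \<Rightarrow> int"
  assumes dims: "length M = n" "\<forall>r\<in>set M. length r = n" "length A = n" "\<forall>r\<in>set A. length r \<le> n" "length ts = n"
    and sym: "List.transpose M = M" and ts: "\<forall>t\<in>set ts. t > 0" and s: "s > 0"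
    and dom: "dominant_from 0 s A ts A M"
  shows "0 \<le> (\<Sum>a<n. \<Sum>b<n. M ! a ! b * x a * x b)"
proof -
  note M_sym = nth_nth_of_transpose[OF sym dims(1,2)]
  define R where "R i j = s * M ! i ! j - dot (A ! i) (A ! j)" for i j
  \<comment> \<open>The rows of A may have different lengths and \<open>dot\<close> stops at the
    shorter one; padding with zeros turns all inner products into sums over one range, hence A A^T
    into a sum of squares of linear forms.\<close>
  define \<alpha> where "\<alpha> i k = (if k < length (A ! i) then A ! i ! k else 0)" for i k
  have dot_A: "dot (A ! i) (A ! j) = (\<Sum>k<n. \<alpha> i k * \<alpha> j k)" if "i < n" "j < n" for i j
  proof -
    have "(\<Sum>k<n. \<alpha> i k * \<alpha> j k) = (\<Sum>k<min (length (A ! i)) (length (A ! j)). \<alpha> i k * \<alpha> j k)"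
    proof (rule sum.mono_neutral_right)
      have "length (A ! i) \<le> n" using dims that by (metis nth_mem)
      then show "{..<min (length (A ! i)) (length (A ! j))} \<subseteq> {..<n}" by auto
    qed (auto simp: \<alpha>_def)
    then show ?thesis by (simp add: dot_conv_sum \<alpha>_def)
  qed
  have "0 \<le> (\<Sum>i<n. \<Sum>j<n. real_of_int (R i j) * real_of_int (x i) * real_of_int (x j))"
  proof (rule diagonally_dominant_nonneg)
    show "real_of_int (R i j) = real_of_int (R j i)" if "i < n" "j < n" for i j
      using that by (simp add: R_def M_sym dot_commute)
    show "0 < real_of_int (ts ! i)" if "i < n" for i
      using ts dims that by simp
    show "(\<Sum>j<n. \<bar>real_of_int (R i j)\<bar> * real_of_int (ts ! j))
        \<le> 2 * real_of_int (R i i) * real_of_int (ts ! i)" if "i < n" for i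
    proof -
      have "(\<Sum>j<n. \<bar>R i j\<bar> * ts ! j) \<le> 2 * R i i * ts ! i"
        using dominant_fromD[OF dom, of i] dims that by (simp add: R_def dominant_rowD)
      then have "real_of_int (\<Sum>j<n. \<bar>R i j\<bar> * ts ! j) \<le> real_of_int (2 * R i i * ts ! i)"
        by (rule of_int_le_iff[THEN iffD2])
      then show ?thesis by simp
    qed
  qed
  also have "\<dots> = real_of_int (\<Sum>i<n. \<Sum>j<n. R i j * x i * x j)" by simp
  finally have R: "0 \<le> (\<Sum>i<n. \<Sum>j<n. R i j * x i * x j)" by (simp only: of_int_0_le_iff)
  have "0 \<le> (\<Sum>k<n. (\<Sum>i<n. \<alpha> i k * x i)\<^sup>2)" by (intro sum_nonneg) simp
  also have "\<dots> = (\<Sum>k<n. \<Sum>i<n. \<Sum>j<n. \<alpha> i k * \<alpha> j k * x i * x j)"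
    by (simp add: power2_eq_square sum_product algebra_simps)
  also have "\<dots> = (\<Sum>i<n. \<Sum>j<n. \<Sum>k<n. \<alpha> i k * \<alpha> j k * x i * x j)"
    by (rule trans[OF sum.swap], rule sum.cong[OF refl], rule sum.swap)
  also have "\<dots> = (\<Sum>i<n. \<Sum>j<n. dot (A ! i) (A ! j) * x i * x j)"
    by (intro sum.cong refl) (simp add: dot_A sum_distrib_right)
  finally have "0 \<le> (\<Sum>i<n. \<Sum>j<n. R i j * x i * x j + dot (A ! i) (A ! j) * x i * x j)"
    using R by (simp add: sum.distrib)
  also have "\<dots> = s * (\<Sum>a<n. \<Sum>b<n. M ! a ! b * x a * x b)"
    by (simp add: R_def sum_distrib_left algebra_simps)
  finally show ?thesis using s by (simp add: zero_le_mult_iff)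
qed

section \<open>Invariance under rotation of the blocks\<close>

lemma length_rot7 [simp]: "length (rot7 xs) = length xs"
  by (induction xs rule: rot7.induct) auto

lemma length_rot7_pow [simp]: "length ((rot7 ^^ k) xs) = length xs"
  by (induction k) auto

lemma map_rot7: "map f (rot7 xs) = rot7 (map f xs)"
  by (induction xs rule: rot7.induct) auto

lemma rot7_pow_7: "(rot7 ^^ 7) xs = xs"
  by (induction xs rule: rot7.induct) (simp_all add: eval_nat_numeral)

lemma dot_rot7: "length xs = length ys \<Longrightarrow> dot (rot7 xs) (rot7 ys) = dot xs ys"
proof (induction xs arbitrary: ys rule: rot7.induct)
  case (1 a b c d e f g xs)
  then obtain a' b' c' d' e' f' g' ys' where "ys = a' # b' # c' # d' # e' # f' # g' # ys'"
    by (auto simp: length_Suc_conv Suc_length_conv)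
  then show ?case using 1 by simp
qed (auto simp: length_Suc_conv Suc_length_conv)

text \<open>The first hypothesis is P M P^T = M for the permutation P performed by
  \<open>rot7\<close>, and P preserves \<open>dot\<close>.\<close>

lemma dot_mat_vec_rot7:
  assumes "rot7 (map rot7 M) = M" "\<forall>r\<in>set M. length r = length y" "length x = length M"
  shows "dot (rot7 x) (mat_vec M (rot7 y)) = dot x (mat_vec M y)"
proof -
  have "mat_vec (map rot7 M) (rot7 y) = mat_vec M y"
    using assms by (simp add: mat_vec_def dot_rot7)
  then have "mat_vec (rot7 (map rot7 M)) (rot7 y) = rot7 (mat_vec M y)"
    by (simp only: mat_vec_def map_rot7)
  then have "mat_vec M (rot7 y) = rot7 (mat_vec M y)" using assms by simp
  then show ?thesis using assms by (simp add: dot_rot7 mat_vec_def)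
qed

lemma dot_mat_vec_rot7_pow:
  assumes "rot7 (map rot7 M) = M" "\<forall>r\<in>set M. length r = length y" "length x = length M"
  shows "dot ((rot7 ^^ k) x) (mat_vec M ((rot7 ^^ k) y)) = dot x (mat_vec M y)"
  using assms by (induction k) (simp_all add: dot_mat_vec_rot7)

lemma dot_mat_vec_sym:
  assumes "List.transpose M = M" "length M = n" "\<forall>r\<in>set M. length r = n" "length x = n" "length y = n"
  shows "dot x (mat_vec M y) = dot y (mat_vec M x)"
proof -
  note M_sym = nth_nth_of_transpose[OF assms(1-3)]
  have "dot x (mat_vec M y) = (\<Sum>a<n. \<Sum>b<n. M ! a ! b * x ! a * y ! b)"
    using assms by (simp add: dot_mat_vec)
  also have "\<dots> = (\<Sum>b<n. \<Sum>a<n. M ! b ! a * y ! b * x ! a)"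
    by (subst sum.swap) (intro sum.cong refl, auto simp: M_sym algebra_simps)
  also have "\<dots> = dot y (mat_vec M x)" using assms by (simp add: dot_mat_vec)
  finally show ?thesis .
qed

section \<open>The crossing form of two red vertices\<close>

fun agreements :: "int \<Rightarrow> int list \<Rightarrow> int" where
  "agreements y (x # xs) = of_bool (x = y) + agreements y xs"
| "agreements y [] = 0"

text \<open>Take an arc of blue vertices with a red vertex at each end. Two edges from the ends into
  the arc interlace exactly when each goes to the farther of the two blue vertices. With
  \<open>xs\<close> the colours at the red vertex before the arc and \<open>ys\<close> those at the
  one after it, this counts such pairs on a common page.\<close>

fun inversions :: "int list \<Rightarrow> int list \<Rightarrow> int" where
  "inversions (x # xs) (y # ys) = agreements y xs + inversions xs ys"
| "inversions [] ys = 0"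
| "inversions xs [] = 0"

text \<open>
  Colours are \<open>1\<close> and \<open>- 1\<close>, for the two pages. The lists \<open>c\<close> and \<open>e\<close> give the colours at two red vertices
  whose gaps differ by \<open>d\<close>, each read cyclically from its own gap; \<open>d = 0\<close> and \<open>d = 7\<close> are the two
  orders of red vertices in the same gap.
\<close>

definition crossing_form :: "nat \<Rightarrow> int list \<Rightarrow> int list \<Rightarrow> int" where
  "crossing_form d c e =
     inversions (take d c) (drop (7 - d) e) + inversions (take (7 - d) e) (drop d c)"

lemma agreements_le: "agreements y xs \<le> int (length xs)" "0 \<le> agreements y xs"
  by (induction xs) auto

lemma inversions_le: "inversions xs ys \<le> int (length xs) * int (length ys)"
proof (induction xs ys rule: inversions.induct)
  case (1 x xs y ys)
  then show ?case using agreements_le[of y xs] by (simp add: algebra_simps)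
qed auto

text \<open>A crude bound is enough, since it only enters through the n diagonal pairs.\<close>

lemma crossing_form_self: "length c = 7 \<Longrightarrow> crossing_form 0 c c \<le> 49"
  using inversions_le[of c c] by (simp add: crossing_form_def)

lemma crossing_form_swap: "d \<le> 7 \<Longrightarrow> crossing_form (7 - d) e c = crossing_form d c e"
  by (simp add: crossing_form_def)

section \<open>Interlacing of edges with labelled blue ends\<close>

definition cyclic_order :: "nat \<Rightarrow> nat list" where
  "cyclic_order p = (rotate1 ^^ p) [0, 1, 2, 3, 4, 5, 6]"

text \<open>Gap p has p blue vertices to its left. Gaps 0 and 7 are the two ends of the spine; as
  one gap of the circle they read the colours in the same order.\<close>

definition relative :: "nat \<Rightarrow> (nat \<Rightarrow> int) \<Rightarrow> int list" where
  "relative p c = map c (cyclic_order p)"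

text \<open>Edge from a red vertex in gap p to blue a, against an edge from a later red vertex in
  gap q to blue b. They cross if both blue ends lie between the gaps with b before a, or both lie on
  the other arc, read q, ..., 6, 0, ..., p - 1, with a before b. The last two disjuncts have a
  before and after the wrap-around.\<close>

definition interleaved :: "nat \<Rightarrow> nat \<Rightarrow> nat \<Rightarrow> nat \<Rightarrow> bool" where
  "interleaved p q a b \<longleftrightarrow> p \<le> b \<and> b < a \<and> a < q \<or> q \<le> a \<and> (a < b \<or> b < p) \<or> a < b \<and> b < p"

text \<open>\<open>inversions\<close> with the colours left symbolic: the index pairs whose colours
  it compares.\<close>

fun inversion_pairs :: "nat list \<Rightarrow> nat list \<Rightarrow> (nat \<times> nat) list" where
  "inversion_pairs (x # xs) (y # ys) = map (\<lambda>z. (z, y)) xs @ inversion_pairs xs ys"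
| "inversion_pairs [] ys = []"
| "inversion_pairs xs [] = []"

lemma agreements_map:
  "agreements (g y) (map f xs) = (\<Sum>(a, b)\<leftarrow>map (\<lambda>z. (z, y)) xs. of_bool (f a = g b))"
  by (induction xs) auto

lemma inversions_map:
  "inversions (map f xs) (map g ys) = (\<Sum>(a, b)\<leftarrow>inversion_pairs xs ys. of_bool (f a = g b))"
  by (induction xs ys rule: inversion_pairs.induct) (simp_all add: agreements_map)

definition crossing_pairs :: "nat \<Rightarrow> nat \<Rightarrow> (nat \<times> nat) list" where
  "crossing_pairs p q =
      inversion_pairs (take (q - p) (cyclic_order p)) (drop (7 - (q - p)) (cyclic_order q)) @
      map prod.swap (inversion_pairs (take (7 - (q - p)) (cyclic_order q)) (drop (q - p) (cyclic_order p)))"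

text \<open>A double loop over a and b, written as one recursion on lists so that
  \<open>code_simp\<close> evaluates it directly.\<close>

fun pairs_check :: "nat \<Rightarrow> nat \<Rightarrow> (nat \<times> nat) list \<Rightarrow> nat list \<Rightarrow> nat list \<Rightarrow> bool" where
  "pairs_check p q L (a # as) (b # bs) =
     (((a, b) \<in> set L) = interleaved p q a b \<and> pairs_check p q L (a # as) bs)"
| "pairs_check p q L (a # as) [] = pairs_check p q L as [0..<7]"
| "pairs_check p q L [] bs = True"

fun bounded_check :: "(nat \<times> nat) list \<Rightarrow> bool" where
  "bounded_check ((a, b) # r) = (a < 7 \<and> b < 7 \<and> bounded_check r)"
| "bounded_check [] = True"

definition gap_check :: "nat \<Rightarrow> nat \<Rightarrow> (nat \<times> nat) list \<Rightarrow> bool" where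
  \<comment> \<open>The leading 0 is a dummy: with the second list empty, the first step drops it
    and starts a full row for each a below 7.\<close>
  "gap_check p q L \<longleftrightarrow> distinct L \<and> bounded_check L \<and> pairs_check p q L (0 # [0..<7]) []"

fun gaps_check :: "(nat \<times> nat) list \<Rightarrow> bool" where
  "gaps_check ((p, q) # r) = (gap_check p q (crossing_pairs p q) \<and> gaps_check r)"
| "gaps_check [] = True"

definition gap_pairs :: "(nat \<times> nat) list" where
  "gap_pairs = concat (map (\<lambda>p. map (Pair p) [p..<8]) [0..<8])"

lemma gaps_checked: "gaps_check gap_pairs"
  by code_simp

lemma gaps_checkD: "gaps_check r \<Longrightarrow> (p, q) \<in> set r \<Longrightarrow> gap_check p q (crossing_pairs p q)"
  by (induction r rule: gaps_check.induct) auto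

lemma bounded_checkD: "bounded_check L \<Longrightarrow> set L \<subseteq> {..<7} \<times> {..<7}"
  by (induction L rule: bounded_check.induct) auto

lemma pairs_checkD:
  assumes "pairs_check p q L as bs"
  shows "(\<forall>b\<in>set bs. as \<noteq> [] \<longrightarrow> ((hd as, b) \<in> set L \<longleftrightarrow> interleaved p q (hd as) b)) \<and>
    (\<forall>a\<in>set (tl as). \<forall>b<7. (a, b) \<in> set L \<longleftrightarrow> interleaved p q a b)"
  using assms
proof (induction p q L as bs rule: pairs_check.induct)
  case (2 p q L a as)
  then show ?case by (cases as) auto
qed auto

text \<open>Unfolding the lists symbolically gives a sum over a set of index pairs that does not
  depend on the colours. That these are the interleaved pairs is a statement about the 36 pairs of
  gaps alone, and is evaluated.\<close>

lemma crossing_form_relative: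
  assumes "p \<le> q" "q \<le> 7"
  shows "crossing_form (q - p) (relative p c) (relative q e) =
    (\<Sum>a<7. \<Sum>b<7. of_bool (interleaved p q a b \<and> c a = e b))"
proof -
  have "(p, q) \<in> set gap_pairs"
    using assms by (auto simp: gap_pairs_def intro!: bexI[of _ p])
  then have check: "gap_check p q (crossing_pairs p q)"
    by (rule gaps_checkD[OF gaps_checked])
  then have dist: "distinct (crossing_pairs p q)"
    and sub: "set (crossing_pairs p q) \<subseteq> {..<7} \<times> {..<7}"
    by (auto simp: gap_check_def dest!: bounded_checkD)
  have mem: "(a, b) \<in> set (crossing_pairs p q) \<longleftrightarrow> interleaved p q a b" if "a < 7" "b < 7" for a b
  proof -
    have "pairs_check p q (crossing_pairs p q) (0 # [0..<7]) []"
      using check by (simp only: gap_check_def)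
    from pairs_checkD[OF this] have "\<forall>a\<in>set [0..<7]. \<forall>b<7.
        (a, b) \<in> set (crossing_pairs p q) \<longleftrightarrow> interleaved p q a b"
      by simp
    moreover have "a \<in> set [0..<7]" using that by simp
    ultimately show ?thesis using that by blast
  qed
  have flip: "of_bool (e a = c b) = (of_bool (c b = e a) :: int)" for a b
    by (rule arg_cong[of _ _ of_bool]) (rule eq_commute)
  have swap: "(\<Sum>(a, b)\<leftarrow>xs. of_bool (e a = c b)) = (\<Sum>(a, b)\<leftarrow>map prod.swap xs. of_bool (c a = e b) :: int)" for xs
    by (induction xs) (auto simp: flip)
  have "crossing_form (q - p) (relative p c) (relative q e) =
      (\<Sum>(a, b)\<leftarrow>crossing_pairs p q. of_bool (c a = e b))"
    unfolding crossing_form_def relative_def take_map drop_map inversions_map swap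
    by (simp add: crossing_pairs_def)
  also have "\<dots> = (\<Sum>(a, b)\<in>set (crossing_pairs p q). of_bool (c a = e b))"
    using dist by (rule sum_list_distinct_conv_sum_set)
  also have "\<dots> = (\<Sum>(a, b)\<in>{..<7} \<times> {..<7}. of_bool (interleaved p q a b \<and> c a = e b))"
    using sub by (intro sum.mono_neutral_cong_left) (auto simp: mem)
  also have "\<dots> = (\<Sum>a<7. \<Sum>b<7. of_bool (interleaved p q a b \<and> c a = e b))"
    by (rule sum.cartesian_product[symmetric])
  finally show ?thesis .
qed

section \<open>The semidefinite certificate\<close>

text \<open>
  The certificate, found by semidefinite programming and exact rounding. The features are
  functionals of degree at most 3 in the colours that vanish on the optimal configurations, as the
  tightness of the bound forces. Each is listed with its 7 rotations; the last odd one is rotation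
  invariant.
\<close>

fun even_features :: "int list \<Rightarrow> int list" where
  "even_features [c1, c2, c3, c4, c5] =
    [1 + c1*c3 + c1*c5 + c3*c5, 0, 0, 0, 0, 0, 0,
     c1*c2 + c1*c5 + c2*c4 + c4*c5, 0, 0, 0, 0, 0, 0,
     c1*c2 - c1*c3 + c2*c3 - c3*c4 + c3*c5 - c4*c5, 0, 0, 0, 0, 0, 0,
     -2 + c1*c2 - c1*c3 + c2*c3 + c3*c4 - c3*c5 + c4*c5, 0, 0, 0, 0, 0, 0,
     -2 + c1*c2 - 2*c1*c4 - c1*c5 + c2*c4 - c4*c5, 0, 0, 0, 0, 0, 2 + c1*c2 + c1*c5 - c2*c4 + 2*c2*c5 - c4*c5,
     1 + c1*c2 - c1*c3 - c2*c3, 0, 0, 0, -1 + c3*c4 + c3*c5 - c4*c5, 0, 0,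
     2 - c1*c2 - 2*c1*c4 + c1*c5 + 3*c2*c4 + c4*c5, 0, 0, 0, 0, -2 - c1*c2 - c1*c5 - 3*c2*c4 + 2*c2*c5 + c4*c5, 0]"
| "even_features _ = []"

definition even_blocks :: "int list list list" where
  "even_blocks =
    [[[103488, -1232, -2968, -45976, -45976, -2968, -1232],
      [-99288, -39480, 21056, 68040, 68040, 21056, -39480],
      [0, 2016, 4032, -3416, 3416, -4032, -2016],
      [42000, 3192, -10248, -13944, -13944, -10248, 3192],
      [7728, -14784, -4368, 0, 4368, 14784, -7728],
      [58828, 27048, 0, -27048, -58828, -14448, 14448],
      [10339, 15680, 1456, -1456, -15680, -10339, 0]],
     [[-99288, -39480, 21056, 68040, 68040, 21056, -39480],
      [150976, 73024, -37408, -108752, -108752, -37408, 73024],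
      [0, -6888, -5320, 728, -728, 5320, 6888],
      [-44632, -16352, 14280, 24416, 24416, 14280, -16352],
      [2352, 14616, 10808, 0, -10808, -14616, -2352],
      [-80276, -49952, 0, 49952, 80276, 33936, -33936],
      [-19320, -21364, -8036, 8036, 21364, 19320, 0]],
     [[0, -2016, -4032, 3416, -3416, 4032, 2016],
      [0, 6888, 5320, -728, 728, -5320, -6888],
      [4424, 1456, -672, -2072, -2072, -672, 1456],
      [0, -1232, -56, 2240, -2240, 56, 1232],
      [-1344, -224, -392, 1820, -392, -224, -1344],
      [-1057, 336, -1372, 336, -1057, 4088, 4088],
      [1232, -630, -1246, -1246, -630, 1232, 2408]],
     [[42000, 3192, -10248, -13944, -13944, -10248, 3192],
      [-44632, -16352, 14280, 24416, 24416, 14280, -16352],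
      [0, 1232, 56, -2240, 2240, -56, -1232],
      [22568, 1512, -9912, -2520, -2520, -9912, 1512],
      [2408, -4200, -3304, 0, 3304, 4200, -2408],
      [24507, 9016, 0, -9016, -24507, -10024, 10024],
      [5096, 5152, 798, -798, -5152, -5096, 0]],
     [[7728, -7728, 14784, 4368, 0, -4368, -14784],
      [2352, -2352, -14616, -10808, 0, 10808, 14616],
      [-1344, -1344, -224, -392, 1820, -392, -224],
      [2408, -2408, 4200, 3304, 0, -3304, -4200],
      [6230, -448, 2408, -504, -504, 2408, -448],
      [-4928, -3766, 5446, 5446, -3766, -4928, -12852],
      [-3633, -1134, -714, 2716, -714, -1134, -3633]],
     [[58828, 14448, -14448, -58828, -27048, 0, 27048],
      [-80276, -33936, 33936, 80276, 49952, 0, -49952],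
      [-1057, 4088, 4088, -1057, 336, -1372, 336],
      [24507, 10024, -10024, -24507, -9016, 0, 9016],
      [-4928, -12852, -4928, -3766, 5446, 5446, -3766],
      [62538, 28672, -4368, -33264, -33264, -4368, 28672],
      [14784, 14784, 4186, -5502, -9758, -5502, 4186]],
     [[10339, 0, -10339, -15680, -1456, 1456, 15680],
      [-19320, 0, 19320, 21364, 8036, -8036, -21364],
      [1232, 2408, 1232, -630, -1246, -1246, -630],
      [5096, 0, -5096, -5152, -798, 798, 5152],
      [-3633, -3633, -1134, -714, 2716, -714, -1134],
      [14784, 4186, -5502, -9758, -5502, 4186, 14784],
      [7056, 2688, 714, -2716, -2716, 714, 2688]]]"

text \<open>An integral approximation to the lower triangular Cholesky factor of 256 times
  \<open>even_matrix\<close>, each row ending at the diagonal; \<open>odd_factor\<close> is the same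
  for 500 times \<open>odd_matrix\<close>. It is chosen so that the remainder keeps enough on its
  diagonal to dominate the rounding errors.\<close>

definition even_factor :: "int list list" where
  "even_factor =
    [[5108],
     [-62, 5108],
     [-149, -64, 5106],
     [-2304, -177, -131, 4554],
     [-2304, -2332, -245, -1332, 3676],
     [-149, -2306, -2338, -399, -1942, 3370],
     [-62, -149, -2309, -2688, -1468, -2965, 1602],
     [-4976, -2039, 885, 1254, 840, 1232, -262, 2123],
     [-1978, -5000, -2099, -72, 160, 287, 355, 98, 2121],
     [1055, -1966, -4972, -1905, -141, 114, 449, -682, 130, 2007],
     [3410, 1096, -1867, -3868, -1443, -84, 449, -332, -667, 35, 1988],
     [3410, 3451, 1198, -326, -2626, -1208, 355, -332, -317, -813, -42, 1907],
     [1055, 3423, 3485, 1951, 1023, -1916, -262, -682, -300, -563, -932, -320, 1633],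
     [-1978, 1031, 3367, 2961, 2178, 1561, -1141, 98, -687, -273, -563, -985, -566, 1532],
     [0, -101, -203, 182, -249, -26, 48, 0, 412, 195, 67, 224, -47, -200, 813],
     [101, 1, -98, -178, 231, -210, 30, -412, 19, 295, 156, -10, 103, -114, 424, 694],
     [202, 103, 7, -7, -91, 291, -74, -210, -403, -45, 271, 117, -82, 57, -40, 521, 623],
     [-171, 200, 99, -76, -142, -199, 74, 63, -213, -401, -54, 262, 142, -57, -510, 265, 299, 491],
     [171, -169, 205, 199, 86, -46, -30, -63, 66, -248, -424, -115, 172, 114, -510, -286, 155, 232, 491],
     [-202, 169, -175, 126, 155, 89, -48, 210, -73, 143, -216, -378, -74, 200, -40, -573, -189, 317, 236, 373],
     [-101, -203, 166, -246, 10, 101, 0, 412, 191, 61, 199, -100, -214, 0, 424, -305, -383, -6, 320, 109, 357],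
     [2105, 185, -450, 275, 536, -530, -68, -159, 41, 69, -88, -70, 55, 30, 0, -290, -89, -107, 227, 10, 13, 415],
     [160, 2107, 191, -408, 331, 664, -312, 33, -160, 57, 77, -72, -56, 62, 248, -151, -181, 29, -105, 162, 6, -30,
     414],
     [-514, 154, 2093, -14, -804, 10, 41, 118, 28, -129, 67, 103, -21, -31, 254, 135, -97, -160, 28, -114, 154,
     -126, -39, 394],
     [-699, -522, 133, 1991, 184, -733, 41, -69, 122, 4, -140, 44, 78, -31, 192, 180, 185, -11, -159, -53, -154,
     67, -121, -22, 391],
     [-699, -707, -543, -217, 1923, 434, -312, -69, -66, 106, 0, -154, 9, 62, -192, 342, 33, 6, -13, -15, -6, 67,
     72, -104, -27, 389],
     [-514, -705, -723, -884, -915, 1552, -68, 118, -75, -28, 122, 36, -103, 30, -254, -70, 292, 16, 6, -4, -13,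
     -126, 58, 37, -92, -17, 378],
     [160, -512, -701, -743, -1254, -1398, 677, 33, 117, -69, -28, 127, 64, -87, -248, -146, -144, 227, 16, 13, 0,
     -30, -128, 49, 40, -89, -22, 378],
     [387, -383, 748, 448, 212, 118, -141, 78, -81, -93, -93, -42, 22, 53, -210, -118, -101, -66, -206, -32, -91,
     74, -69, 37, 2, 10, -2, -41, 513],
     [-741, 378, -404, 459, 219, 126, -68, 118, 72, -47, -81, -73, -14, 38, -142, -159, -150, -206, -69, -94, -5,
     -19, 73, -77, 42, 6, 0, -5, 461, 226],
     [-219, -744, 372, -563, 241, 144, 0, 75, 115, 100, -34, -58, -41, 0, 16, -177, -125, -159, -207, -32, -88,
     -32, -22, 66, -76, 42, 5, 0, 462, 104, 197],
     [0, -219, -744, 405, -580, 171, 68, 0, 75, 120, 106, -20, -42, -38, 11, 12, -195, -224, -162, -96, -5, 0, -32,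
     -23, 67, -75, 41, 5, 460, 111, 62, 188],
     [219, 3, -213, -726, 400, -579, 141, -75, 3, 54, 114, 99, -29, -53, 16, 2, 20, -232, -226, -102, -91, 32, 2,
     -23, -26, 65, -72, 41, 460, 107, 68, 46, 183],
     [741, 228, 24, 139, -369, 597, -151, -118, -70, -36, 38, 85, 65, -45, -142, 106, -84, -127, -235, -96, -71,
     19, 33, 9, -26, -29, 74, -70, 462, 102, 60, 50, 35, 178],
     [-387, 736, 217, -161, -124, -576, 151, -78, -115, -98, -50, 8, 40, 45, -210, -39, 40, -204, -130, -116, -71,
     -74, 14, 11, 18, -19, -45, 70, 461, 110, 59, 43, 40, 28, 176],
     [2948, 760, -629, -1804, -250, -144, 78, -521, -189, 61, 405, -390, -76, 207, 124, 104, 121, 205, 719, 324,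
     247, 59, 28, -4, -64, -34, -2, 27, -908, -317, -67, -137, -66, -52, -89, 589],
     [1355, 2965, 801, 12, -1309, -164, 0, 272, -534, -98, 95, 499, -220, 0, 402, -100, 309, 536, 214, 331, 238,
     13, 60, 35, -7, -68, -27, 0, -941, -142, -203, -23, -108, -43, -37, 20, 589],
     [0, 1356, 2966, 950, 396, -1142, -78, 0, 273, -569, -126, 37, 467, -207, 330, 269, -42, 476, 541, -48, 247, 0,
     13, 64, 33, -9, -65, -27, -924, -251, -62, -173, -7, -96, -37, 91, 17, 581],
     [-1355, -16, 1316, 2658, 1198, 750, -611, -272, 13, 195, -601, -213, -152, 366, 402, 141, 432, 284, 483, 266,
     -118, -13, -1, 9, 65, 35, -14, -67, -924, -214, -168, -32, -156, 4, -89, -31, 92, 22, 580],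
     [-2948, -1391, -103, -28, 1349, 718, -182, 521, -297, 196, 275, -449, 23, -16, 124, 395, 108, 515, 287, 390,
     289, -59, -17, -20, 17, 72, 19, -18, -941, -181, -105, -124, -4, -133, 18, -31, -30, 98, 20, 579],
     [-724, -2957, -1414, -522, -729, 950, 182, 213, 512, -249, 212, 324, -396, 16, 153, 52, 491, 378, 521, -36,
     289, -24, -61, -27, -16, 21, 66, 18, -908, -286, -128, -91, -119, -3, -134, 91, -34, -45, 105, 27, 569],
     [724, -715, -2937, -1266, -655, -968, 611, -213, 223, 465, -260, 192, 356, -366, 153, 86, 100, 717, 385, 222,
     -118, 24, -22, -57, -28, -17, 23, 67, -954, -115, -151, -70, -52, -87, 18, 20, 91, -37, -44, 106, 23, 568],
     [518, 6, -503, -634, -36, -307, 137, -316, 15, 226, 32, 124, -101, 12, 275, 52, 333, -49, 19, 24, -93, 31, 2,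
     -23, -6, -25, 23, 2, -505, -117, -10, -62, 20, -52, 11, 3, 42, -65, 66, -52, 31, 6, 266],
     [786, 528, 29, -162, -322, 101, -26, -79, -313, -6, 220, 24, 130, -91, -62, 360, -60, 232, -49, 68, 50, 0, 31,
     3, -23, -6, -25, 23, -482, -163, -97, -8, -62, 19, -53, 3, 3, 42, -65, 65, -53, 31, -65, 258],
     [73, 787, 530, 83, -110, -335, 26, -71, -75, -354, -31, 175, -47, 91, -129, 6, 345, -38, 232, -82, 50, 12, 1,
     37, 0, -26, -1, -23, -502, -72, -99, -74, 7, -49, 27, 42, 2, -4, 45, -62, 59, -54, 86, -45, 247],
     [-73, 72, 785, 570, 259, 22, -137, 71, -75, -54, -350, -31, 203, -12, -129, -73, -29, 377, -35, 161, -93, -12,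
     12, -3, 39, 2, -30, -2, -477, -168, -50, -95, -77, 2, -53, -62, 45, 12, -8, 40, -52, 61, -1, 88, -53, 245],
     [-786, -82, 49, 482, 353, 204, -110, 79, 68, -53, -47, -351, -69, 186, -62, -113, -78, -60, 376, 0, 181, 0,
     -12, 12, -3, 38, 2, -30, -502, -59, -99, -21, -77, -63, 11, 69, -65, 34, 16, -3, 29, -54, -1, -1, 92, -50,
     244],
     [-518, -792, -98, -214, 181, 231, 0, 316, 64, 179, -5, 54, -198, 0, 275, -241, 50, 170, -55, 173, -52, -31,
     -2, -23, 17, 1, 30, 0, -482, -156, -27, -88, -17, -75, -64, -62, 71, -55, 31, 12, 7, 31, 86, 21, -27, 80, -44,
     232],
     [0, -518, -793, -125, -325, 84, 110, 0, 316, 63, 181, 4, 82, -186, 187, 207, -243, 17, 170, -42, 181, 0, -31,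
     -3, -23, 17, 0, 30, -505, -66, -88, 3, -68, 1, -64, 42, -64, 65, -53, 33, 6, 6, -65, 72, 35, -20, 76, -32,
     230]]"

text \<open>Row weights for the dominance test, one value per block of 7, as the rotation symmetry
  suggests.\<close>

definition even_weights :: "int list" where
  "even_weights =
    [5, 5, 5, 5, 5, 5, 5, 4, 4, 4, 4, 4, 4, 4, 23, 23, 23, 23, 23, 23, 23, 10, 10, 10, 10, 10, 10, 10, 20, 20, 20,
     20, 20, 20, 20, 6, 6, 6, 6, 6, 6, 6, 19, 19, 19, 19, 19, 19, 19]"

fun odd_features :: "int list \<Rightarrow> int list" where
  "odd_features [c1, c2, c3, c4, c5] =
    [c1 + c3 + c5 + c1*c3*c5, 0, 0, 0, 0, 0, 0,
     -c2 + c3 - c4 + c2*c3*c4, 0, 0, 0, 0, 0, 0,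
     -c1 + c2 - c4 + c5 + c1*c2*c3 - c3*c4*c5, 0, 0, 0, 0, 0, 0,
     -c1 + c2 - 2*c3 + c4 - c5 + c1*c2*c3 + c3*c4*c5, 0, 0, 0, 0, 0, 0,
     -c1 + c2 - c4 + c1*c2*c4, 0, 0, 0, 0, 0, -c2 + c4 - c5 + c2*c4*c5,
     c2 - c3, 0, 0, 0, -c3 + c4, 0, 0,
     c1 - c2 - c4 + c1*c2*c4, 0, 0, 0, 0, -c2 - c4 + c5 + c2*c4*c5, 0,
     3*c1 + 4*c2 + 2*c3 + 4*c4 + 3*c5 - c1*c2*c4 - c2*c4*c5, 3*c1 + 4*c2 + 2*c3 + 4*c4 + 3*c5 - c1*c2*c4 - c2*c4*c5, 3*c1 + 4*c2 + 2*c3 + 4*c4 + 3*c5 - c1*c2*c4 - c2*c4*c5, 3*c1 + 4*c2 + 2*c3 + 4*c4 + 3*c5 - c1*c2*c4 - c2*c4*c5, 3*c1 + 4*c2 + 2*c3 + 4*c4 + 3*c5 - c1*c2*c4 - c2*c4*c5, 3*c1 + 4*c2 + 2*c3 + 4*c4 + 3*c5 - c1*c2*c4 - c2*c4*c5, 3*c1 + 4*c2 + 2*c3 + 4*c4 + 3*c5 - c1*c2*c4 - c2*c4*c5]"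
| "odd_features _ = []"

text \<open>The invariant last feature is repeated 7 times so that it fits the block format. On
  constant blocks only the total of a matrix block matters, so its diagonal block can be a multiple
  of the identity, which is nonsingular.\<close>

definition odd_blocks :: "int list list list" where
  "odd_blocks =
    [[[16632, 9072, 2016, 0, 0, 2016, 9072],
      [2576, 2968, 5376, 8232, 8232, 5376, 2968],
      [0, -112, -1120, 56, -56, 1120, 112],
      [9688, 4032, -392, -280, -280, -392, 4032],
      [5096, 4144, 3864, 3724, 3864, 4144, 5096],
      [0, -504, 0, -504, 0, 4704, 4704],
      [-280, -280, -560, -560, -280, -280, 1624],
      [0, 0, 0, 0, 0, 0, 0]],
     [[2576, 2968, 5376, 8232, 8232, 5376, 2968],
      [13552, 9016, 6440, 7448, 7448, 6440, 9016],
      [0, 728, -3192, 280, -280, 3192, -728],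
      [-2856, -1904, -2296, -3080, -3080, -2296, -1904],
      [5824, 840, 3360, 5488, 3360, 840, 5824],
      [12712, 14896, 15288, 14896, 12712, -2352, -2352],
      [-2072, 1232, -4368, -4368, 1232, -2072, -4648],
      [-384, -384, -384, -384, -384, -384, -384]],
     [[0, 112, 1120, -56, 56, -1120, -112],
      [0, -728, 3192, -280, 280, -3192, 728],
      [10640, -4760, 3248, -3584, -3584, 3248, -4760],
      [0, 3808, 2912, 2296, -2296, -2912, -3808],
      [-3136, 2240, 1344, 0, -1344, -2240, 3136],
      [-16072, -10304, 0, 10304, 16072, -2464, 2464],
      [896, 2100, -4200, 4200, -2100, -896, 0],
      [0, 0, 0, 0, 0, 0, 0]],
     [[9688, 4032, -392, -280, -280, -392, 4032],
      [-2856, -1904, -2296, -3080, -3080, -2296, -1904],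
      [0, -3808, -2912, -2296, 2296, 2912, 3808],
      [20328, 11984, 5208, 3976, 3976, 5208, 11984],
      [-1904, -840, -3808, -5152, -3808, -840, -1904],
      [-16016, 3024, 11536, 3024, -16016, -18480, -18480],
      [4648, 2240, 4928, 4928, 2240, 4648, 7672],
      [8, 8, 8, 8, 8, 8, 8]],
     [[5096, 5096, 4144, 3864, 3724, 3864, 4144],
      [5824, 5824, 840, 3360, 5488, 3360, 840],
      [-3136, 3136, -2240, -1344, 0, 1344, 2240],
      [-1904, -1904, -840, -3808, -5152, -3808, -840],
      [21896, 14448, 12544, 17808, 17808, 12544, 14448],
      [-5992, 0, -6720, -6720, 0, -5992, -21336],
      [-7336, -784, -2828, -10836, -2828, -784, -7336],
      [1256, 1256, 1256, 1256, 1256, 1256, 1256]],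
     [[0, 4704, 4704, 0, -504, 0, -504],
      [12712, -2352, -2352, 12712, 14896, 15288, 14896],
      [-16072, 2464, -2464, 16072, 10304, 0, -10304],
      [-16016, -18480, -18480, -16016, 3024, 11536, 3024],
      [-5992, -21336, -5992, 0, -6720, -6720, 0],
      [115416, 54992, -3136, -28224, -28224, -3136, 54992],
      [1792, 1792, -10136, -4872, 12152, -4872, -10136],
      [-1536, -1536, -1536, -1536, -1536, -1536, -1536]],
     [[-280, 1624, -280, -280, -560, -560, -280],
      [-2072, -4648, -2072, 1232, -4368, -4368, 1232],
      [896, 0, -896, -2100, 4200, -4200, 2100],
      [4648, 7672, 4648, 2240, 4928, 4928, 2240],
      [-7336, -7336, -784, -2828, -10836, -2828, -784],
      [1792, -10136, -4872, 12152, -4872, -10136, 1792],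
      [11200, 392, -1624, 6384, 6384, -1624, 392],
      [-256, -256, -256, -256, -256, -256, -256]],
     [[0, 0, 0, 0, 0, 0, 0],
      [-384, -384, -384, -384, -384, -384, -384],
      [0, 0, 0, 0, 0, 0, 0],
      [8, 8, 8, 8, 8, 8, 8],
      [1256, 1256, 1256, 1256, 1256, 1256, 1256],
      [-1536, -1536, -1536, -1536, -1536, -1536, -1536],
      [-256, -256, -256, -256, -256, -256, -256],
      [1152, 0, 0, 0, 0, 0, 0]]]"

definition odd_factor :: "int list list" where
  "odd_factor =
    [[2862],
     [1585, 2383],
     [352, 1669, 2298],
     [0, 423, 1667, 2288],
     [0, 0, 439, 1663, 2288],
     [352, -234, 116, 399, 1670, 2247],
     [1585, -631, 215, -40, 429, 1382, 1772],
     [450, 323, 866, 1109, 827, 303, 34, 1900],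
     [519, 196, 424, 830, 1115, 773, 218, 927, 1659],
     [939, -2, 418, 345, 844, 974, 475, 550, 754, 1655],
     [1438, 172, 301, 312, 364, 647, 475, 1001, 71, 699, 1455],
     [1438, 771, 389, 222, 327, 213, 218, 1001, 587, 31, 478, 1427],
     [939, 1103, 846, 355, 229, 264, 34, 550, 839, 584, 19, 484, 1425],
     [519, 783, 1143, 822, 359, 189, 187, 927, 112, 790, 285, -77, 511, 1330],
     [0, 23, 227, -182, 101, -301, 156, 0, -137, 1088, -565, 272, -1642, 304, 802],
     [-20, 13, 18, 229, -182, 111, -333, 120, -67, -147, 1159, -492, 255, -1642, -475, 647],
     [-196, 107, -47, 39, 225, -143, 292, -894, 636, 7, 424, 1413, -568, 827, 346, -335, 642],
     [10, -241, 150, -64, 43, 195, -292, 38, -1044, 601, -264, 319, 1441, -827, -183, 295, -341, 638],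
     [-10, 18, -255, 158, -66, 63, 333, -38, 64, -1042, 680, -205, 305, 1642, -183, -361, 343, -299, 522],
     [196, -142, 85, -281, 163, -121, -156, 894, -542, -7, -1752, 344, -117, -304, 346, 28, -401, 308, -150, 495],
     [20, 222, -176, 100, -283, 197, 0, -120, 1090, -500, 319, -1651, 326, 0, -475, 81, 70, -366, 166, -108, 483],
     [1693, -280, -142, 94, -102, -315, -186, -997, -284, -887, -1338, -1228, -215, 495, 0, -229, -131, -216, 112,
     90, 181, 1131],
     [704, 1564, -367, -108, 87, -37, -134, -734, -732, -265, -865, -1400, -1205, -378, 185, 136, -260, -160, -71,
     56, 127, 874, 717],
     [-68, 891, 1471, -355, -110, 110, 54, -1173, -185, -670, 179, -709, -1440, -989, 9, 236, 118, -276, -83, -103,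
     83, 876, 311, 644],
     [-49, -50, 921, 1456, -353, -128, 54, -1886, -291, -84, 49, 450, -785, -989, 201, 159, 205, 94, -185, -112,
     -83, 899, 285, 175, 599],
     [-49, -26, -59, 929, 1454, -340, -134, -1886, -1107, -217, 496, 289, 385, -378, -201, 102, 173, 220, 12, -157,
     -127, 899, 322, 160, 101, 575],
     [-68, -13, -41, -53, 928, 1487, -186, -1173, -1504, -1090, -129, 532, 277, 495, -9, -256, 122, 193, 134, 40,
     -181, 876, 350, 218, 109, 74, 569],
     [704, -551, 231, -128, -37, 768, 1287, -734, -934, -1495, -1194, -230, 561, 81, -185, -147, -228, 146, 81,
     186, 0, 874, 315, 237, 166, 84, 64, 566],
     [890, 477, 419, 451, 406, 367, 118, 549, 322, -1236, -68, -50, -151, -735, -250, 126, -36, -128, -50, 176, 12,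
     -2143, -767, -412, -353, -234, -241, -131, 912],
     [724, 588, 571, 381, 458, 339, 216, -790, 1070, 405, -735, 78, -90, 123, 189, -171, 121, -40, -129, -39, 174,
     -2105, -813, -508, -280, -286, -209, -225, 711, 570],
     [675, 421, 700, 526, 389, 379, 134, -205, -790, 1059, 388, -736, 82, -128, -17, 223, -187, 106, 41, -179, 0,
     -2148, -702, -504, -342, -190, -247, -182, 682, 287, 533],
     [651, 378, 527, 660, 533, 319, 216, 314, -410, -824, 918, 391, -740, 123, 0, -21, 226, -184, 116, 27, -174,
     -2131, -788, -418, -351, -264, -157, -225, 725, 186, 190, 485],
     [675, 332, 496, 483, 668, 455, 118, -205, 474, -383, -730, 934, 382, -735, 17, 12, -24, 225, -225, 166, -12,
     -2148, -742, -492, -255, -260, -226, -131, 725, 255, 102, 116, 466],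
     [724, 329, 460, 448, 492, 586, 286, -790, 206, 529, 11, -598, 903, 620, -189, -118, 40, 1, 117, -198, 159,
     -2105, -820, -483, -364, -192, -235, -210, 682, 309, 202, 66, 102, 465],
     [890, 277, 503, 396, 460, 373, 286, 549, -1212, 134, 27, -172, -549, 620, 250, -51, -141, 20, 130, 48, -159,
     -2143, -707, -515, -320, -277, -155, -210, 711, 203, 221, 136, 34, 95, 455],
     [0, 987, 307, -406, 126, 65, 81, 3207, -2617, -701, 2447, 2639, 4149, 1389, -931, -111, -133, 885, 462, 140,
     -627, 1015, 541, 339, 37, 313, 282, 240, -575, -345, -62, 72, -118, -85, 82, 1182],
     [-88, 59, 994, 293, -404, 104, 2, 3465, 1738, -2771, -2079, 1884, 2784, 3375, -176, -1284, 2, -35, 460, 642,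
     0, 1171, 173, 304, 200, -51, 270, 254, -502, -293, -337, -87, 54, -123, -100, 151, 1172],
     [0, -106, 77, 992, 293, -409, 81, 3363, 2091, 1612, -4132, -2830, 2104, 1389, 0, -218, -1278, -2, -21, 481,
     627, 1185, 402, -24, 166, 117, -92, 240, -612, -40, -180, -249, -50, 63, -100, -46, 158, 1170],
     [-88, 59, -139, 90, 989, 322, -372, 3465, 1917, 1954, 773, -4483, -2716, 1466, 176, 129, -248, -1313, 270,
     -181, 605, 1171, 441, 251, -125, 92, 83, -118, -612, -215, 39, -100, -215, -44, 82, -133, -29, 151, 1164],
     [0, -106, 77, -147, 92, 989, 483, 3207, 2178, 1804, 1348, 634, -4455, -3061, 931, 902, -32, -390, -683, 56,
     -45, 1015, 609, 406, 279, -94, 107, 96, -502, -352, -215, 25, -111, -219, -59, -133, -117, -35, 139, 1159],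
     [822, -547, 161, -16, -129, -95, 483, -722, 4076, 2361, 3557, 2200, 394, -3061, -461, 816, 895, -32, -474,
     -630, 45, 1127, 226, 414, 317, 243, -108, 96, -575, -86, -265, -154, 55, -103, -203, -46, -129, -119, -39,
     136, 1159],
     [822, 440, -446, 133, -11, -187, -372, -722, -424, 4114, 3067, 4042, 2051, 1466, 461, -234, 793, 886, -14,
     -507, -605, 1127, 403, 54, 311, 272, 228, -118, -665, -91, 39, -138, -88, 71, -59, 151, -65, -120, -104, -27,
     140, 1151],
     [-49, 373, -325, 106, -137, 22, 156, -458, -1082, 120, 756, -1096, -481, 787, -68, -50, 95, -178, 206, -152,
     -5, 837, 364, 156, 119, 91, 78, 69, -220, -77, 88, 2, -52, 11, 62, 31, -56, 15, 31, 1, -55, 35, 337],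
     [-49, -26, 380, -333, 108, -160, -78, 341, -715, -1129, -255, 620, -1064, -731, 185, 52, -73, 75, -93, 186,
     -149, 844, 291, 253, 101, 89, 78, 70, -137, -181, -104, 57, -15, -56, -2, 31, 27, -55, 17, 34, 1, -59, 39,
     335],
     [-98, 6, -51, 391, -335, 136, -78, -1206, 1064, -610, -455, -36, 562, -731, -279, 24, 79, -49, -56, -29, 149,
     848, 298, 173, 193, 72, 77, 70, -172, -6, -154, -95, 59, -14, -55, -52, 37, 24, -60, 12, 33, 9, -37, 44, 333],
     [-98, -52, -8, -46, 390, -334, 156, -1206, -708, 1115, -269, -352, -62, 787, 279, -141, 7, 64, 32, -102, 5,
     848, 303, 183, 110, 161, 60, 69, -213, -8, 42, -109, -77, 63, -2, 6, -53, 38, 25, -59, 12, 31, 52, -43, 51,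
     327],
     [-49, -85, -53, -7, -46, 398, -359, 341, -1572, -782, 663, -407, -314, -340, -185, 210, -139, 8, 72, 22, -98,
     844, 308, 192, 124, 79, 148, 52, -172, -127, -6, 49, -106, -77, 62, 31, 2, -51, 41, 28, -58, 9, 52, 46, -38,
     44, 325],
     [-49, -26, -95, -48, -8, -38, 535, -458, 646, -1527, -558, 730, -430, -171, 68, -179, 218, -131, -35, 101, 0,
     837, 311, 200, 138, 98, 68, 142, -137, -103, -134, -26, 37, -109, -88, 6, 30, 2, -51, 41, 28, -59, -37, 56,
     41, -31, 47, 323],
     [284, -247, 75, -131, -41, -82, -359, -1168, 128, 721, -1125, -479, 712, -340, 0, 84, -187, 212, -126, -27,
     98, 878, 249, 168, 115, 88, 75, 52, -220, 55, -41, -76, 5, 45, -88, -52, 13, 27, -3, -56, 40, 35, 39, -42, 62,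
     32, -36, 53, 319],
     [0, 0, 0, 0, 0, 0, 0, -101, -59, -55, -33, -27, -29, -20, 0, 0, 0, 0, 0, 0, 0, -209, -75, -47, -32, -24, -21,
     -18, 69, 24, 17, 11, 8, 7, 6, -3, -3, -3, -3, -4, -4, -3, -3, -3, -3, -2, -2, -3, -2, 698],
     [0, 0, 0, 0, 0, 0, 0, -101, -59, -55, -33, -27, -29, -20, 0, 0, 0, 0, 0, 0, 0, -209, -75, -47, -32, -24, -21,
     -18, 69, 24, 17, 11, 8, 7, 6, -3, -3, -3, -3, -4, -4, -3, -3, -3, -3, -2, -2, -3, -2, -114, 689],
     [0, 0, 0, 0, 0, 0, 0, -101, -59, -55, -33, -27, -29, -20, 0, 0, 0, 0, 0, 0, 0, -209, -75, -47, -32, -24, -21,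
     -18, 69, 24, 17, 11, 8, 7, 6, -3, -3, -3, -3, -4, -4, -3, -3, -3, -3, -2, -2, -3, -2, -114, -135, 676],
     [0, 0, 0, 0, 0, 0, 0, -101, -59, -55, -33, -27, -29, -20, 0, 0, 0, 0, 0, 0, 0, -209, -75, -47, -32, -24, -21,
     -18, 69, 24, 17, 11, 8, 7, 6, -3, -3, -3, -3, -4, -4, -3, -3, -3, -3, -2, -2, -3, -2, -114, -135, -164, 656],
     [0, 0, 0, 0, 0, 0, 0, -101, -59, -55, -33, -27, -29, -20, 0, 0, 0, 0, 0, 0, 0, -209, -75, -47, -32, -24, -21,
     -18, 69, 24, 17, 11, 8, 7, 6, -3, -3, -3, -3, -4, -4, -3, -3, -3, -3, -2, -2, -3, -2, -114, -135, -164, -210,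
     621],
     [0, 0, 0, 0, 0, 0, 0, -101, -59, -55, -33, -27, -29, -20, 0, 0, 0, 0, 0, 0, 0, -209, -75, -47, -32, -24, -21,
     -18, 69, 24, 17, 11, 8, 7, 6, -3, -3, -3, -3, -4, -4, -3, -3, -3, -3, -2, -2, -3, -2, -114, -135, -164, -210,
     -293, 548],
     [0, 0, 0, 0, 0, 0, 0, -101, -59, -55, -33, -27, -29, -20, 0, 0, 0, 0, 0, 0, 0, -209, -75, -47, -32, -24, -21,
     -18, 69, 24, 17, 11, 8, 7, 6, -3, -3, -3, -3, -4, -4, -3, -3, -3, -3, -2, -2, -3, -2, -114, -135, -164, -210,
     -293, -488, 248]]"

definition odd_weights :: "int list" where
  "odd_weights =
    [11, 11, 11, 11, 11, 11, 11, 12, 12, 12, 12, 12, 12, 12, 13, 13, 13, 13, 13, 13, 13, 10, 10, 10, 10, 10, 10,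
     10, 9, 9, 9, 9, 9, 9, 9, 4, 4, 4, 4, 4, 4, 4, 13, 13, 13, 13, 13, 13, 13, 40, 40, 40, 40, 40, 40, 40]"

definition "even_matrix = block_circulant even_blocks"
definition "odd_matrix = block_circulant odd_blocks"

text \<open>
  For \<open>d = 0\<close> the crossing form also depends on the first colour of \<open>c\<close> and the last colour of \<open>e\<close>; the
  other end colours never matter for \<open>d \<le> 3\<close>.
\<close>

fun pair_check :: "nat \<Rightarrow> int list \<Rightarrow> int list \<Rightarrow> int list \<Rightarrow> (int list \<times> int list \<times> int list) list \<Rightarrow> bool" where
  "pair_check d c v w ((e, x, y) # rest) =
     (list_all (\<lambda>q. 2 * (dot v x + dot w y) \<le> 351232 * (2 * q - 9))
        (if d = 0 then [crossing_form 0 (1 # c @ [1]) (1 # e @ [1]), crossing_form 0 (1 # c @ [1]) (1 # e @ [- 1]),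
                        crossing_form 0 (- 1 # c @ [1]) (1 # e @ [1]), crossing_form 0 (- 1 # c @ [1]) (1 # e @ [- 1])]
         else [crossing_form d (1 # c @ [1]) (1 # e @ [1])]) \<and> pair_check d c v w rest)"
| "pair_check d c v w [] = True"

definition "sign_lists = product_lists (replicate 5 [1, - 1 :: int])"

definition "rotated_features d =
  map (\<lambda>e. (e, (rot7 ^^ d) (even_features e), (rot7 ^^ d) (odd_features e))) sign_lists"

fun all_check :: "nat \<Rightarrow> (int list \<times> int list \<times> int list) list \<Rightarrow> (int list \<times> int list \<times> int list) list \<Rightarrow> bool" where
  "all_check d fs ((c, v, w) # rest) = (pair_check d c v w fs \<and> all_check d fs rest)"
| "all_check d fs [] = True"

text \<open>Applying the matrices once per colouring leaves two inner products for each of the 32 by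
  32 pairs of colourings.\<close>

definition "weighted_features =
  map (\<lambda>c. (c, mat_vec even_matrix (even_features c), mat_vec odd_matrix (odd_features c))) sign_lists"

section \<open>Evaluation of the certificate\<close>

lemma even_matrix_dims: "length even_matrix = 49" "list_all (\<lambda>r. length r = 49) even_matrix"
  and odd_matrix_dims: "length odd_matrix = 56" "list_all (\<lambda>r. length r = 56) odd_matrix"
  by code_simp+

lemma factor_dims: "length even_factor = 49" "list_all (\<lambda>r. length r \<le> 49) even_factor"
    "length odd_factor = 56" "list_all (\<lambda>r. length r \<le> 56) odd_factor"
  and weights_dims: "length even_weights = 49" "list_all (\<lambda>t. 0 < t) even_weights"
    "length odd_weights = 56" "list_all (\<lambda>t. 0 < t) odd_weights"
  by code_simp+

lemma matrix_shift: "rot7 (map rot7 even_matrix) = even_matrix" "rot7 (map rot7 odd_matrix) = odd_matrix"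
  by code_simp+

lemma matrix_transpose: "List.transpose even_matrix = even_matrix" "List.transpose odd_matrix = odd_matrix"
  by code_simp+

lemma even_dominant: "dominant_from 0 256 even_factor even_weights even_factor even_matrix"
  by code_simp

lemma odd_dominant: "dominant_from 0 500 odd_factor odd_weights odd_factor odd_matrix"
  by code_simp

text \<open>The nonnegative part of the decomposition, for cyclic difference 0. Differences 4 to 7
  need no evaluation: exchanging the two red vertices replaces d by 7 - d.\<close>

lemma all_checked_0: "all_check 0 (rotated_features 0) weighted_features"
  by code_simp

lemma all_checked_1: "all_check 1 (rotated_features 1) weighted_features"
  by code_simp

lemma all_checked_2: "all_check 2 (rotated_features 2) weighted_features"
  by code_simp

lemma all_checked_3: "all_check 3 (rotated_features 3) weighted_features"
  by code_simp

lemma pair_checkD: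
  assumes "pair_check d c v w fs" "(e, x, y) \<in> set fs"
  shows "list_all (\<lambda>q. 2 * (dot v x + dot w y) \<le> 351232 * (2 * q - 9))
        (if d = 0 then [crossing_form 0 (1 # c @ [1]) (1 # e @ [1]), crossing_form 0 (1 # c @ [1]) (1 # e @ [- 1]),
                        crossing_form 0 (- 1 # c @ [1]) (1 # e @ [1]), crossing_form 0 (- 1 # c @ [1]) (1 # e @ [- 1])]
         else [crossing_form d (1 # c @ [1]) (1 # e @ [1])])"
  using assms by (induction d c v w fs rule: pair_check.induct) auto

lemma all_checkD: "all_check d fs cs \<Longrightarrow> (c, v, w) \<in> set cs \<Longrightarrow> pair_check d c v w fs"
  by (induction d fs cs rule: all_check.induct) auto

lemma all_checked: "d \<le> 3 \<Longrightarrow> all_check d (rotated_features d) weighted_features"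
  using all_checked_0 all_checked_1 all_checked_2 all_checked_3
  by (auto simp: numeral_eq_Suc le_Suc_eq)

section \<open>The semidefinite form on types\<close>

lemma sign_lists_iff:
  "c \<in> set sign_lists \<longleftrightarrow> (\<exists>c1 c2 c3 c4 c5. c = [c1, c2, c3, c4, c5] \<and> {c1, c2, c3, c4, c5} \<subseteq> {1, - 1})"
  unfolding sign_lists_def product_lists_set
  by (auto simp: numeral_eq_Suc list_all2_Cons2)

lemma sign_listE:
  assumes "c \<in> set sign_lists"
  obtains c1 c2 c3 c4 c5 where "c = [c1, c2, c3, c4, c5]"
  using assms unfolding sign_lists_iff by blast

lemma length_features [simp]:
  assumes "c \<in> set sign_lists"
  shows "length (even_features c) = 49" "length (odd_features c) = 56"
  using assms by (auto elim!: sign_listE)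

text \<open>The semidefinite form at two types, a gap with the five inner colours each. It is
  normalised to lie below 351232 (Q - 9/2); the inequalities are doubled to avoid the
  fraction.\<close>

definition energy :: "nat \<Rightarrow> int list \<Rightarrow> nat \<Rightarrow> int list \<Rightarrow> int" where
  "energy p c q e =
     dot ((rot7 ^^ p) (even_features c)) (mat_vec even_matrix ((rot7 ^^ q) (even_features e))) +
     dot ((rot7 ^^ p) (odd_features c)) (mat_vec odd_matrix ((rot7 ^^ q) (odd_features e)))"

lemma dims_ball: "\<forall>r\<in>set even_matrix. length r = 49" "\<forall>r\<in>set odd_matrix. length r = 56"
  using even_matrix_dims odd_matrix_dims by (simp_all add: list_all_iff)

lemma energy_swap:
  assumes "c \<in> set sign_lists" "e \<in> set sign_lists"
  shows "energy p c q e = energy q e p c"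
  unfolding energy_def using assms
  by (simp add: dot_mat_vec_sym[OF matrix_transpose(1) even_matrix_dims(1) dims_ball(1), of "(rot7 ^^ p) (even_features c)"]
      dot_mat_vec_sym[OF matrix_transpose(2) odd_matrix_dims(1) dims_ball(2), of "(rot7 ^^ p) (odd_features c)"])

lemma energy_shift:
  assumes "c \<in> set sign_lists" "e \<in> set sign_lists"
  shows "energy (k + p) c (k + q) e = energy p c q e"
  unfolding energy_def funpow_add comp_def using assms
  by (simp add: dot_mat_vec_rot7_pow[OF matrix_shift(1)] dot_mat_vec_rot7_pow[OF matrix_shift(2)]
      dims_ball even_matrix_dims odd_matrix_dims)

lemma energy_7: "energy p c 7 e = energy p c 0 e"
  by (simp add: energy_def rot7_pow_7 del: funpow.simps)

text \<open>An edge to a blue neighbour passes over no other blue vertex, so it can cross an edge of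
  another red vertex only if that red vertex lies between its two ends.\<close>

lemma crossing_form_core:
  assumes "c \<in> set sign_lists" "e \<in> set sign_lists"
  shows "crossing_form 0 (x # c @ [x']) (z # e @ [z']) = crossing_form 0 (x # c @ [1]) (1 # e @ [z'])"
    and "d \<in> {1, 2, 3} \<Longrightarrow> crossing_form d (x # c @ [x']) (z # e @ [z']) = crossing_form d (1 # c @ [1]) (1 # e @ [1])"
  using assms by (auto elim!: sign_listE simp: crossing_form_def)

lemma energy_le_small:
  assumes "c \<in> set sign_lists" "e \<in> set sign_lists" "{x, x', z, z'} \<subseteq> {1, - 1}" "d \<le> 3"
  shows "2 * energy 0 c d e \<le> 351232 * (2 * crossing_form d (x # c @ [x']) (z # e @ [z']) - 9)"
proof -
  let ?v = "mat_vec even_matrix (even_features c)" and ?w = "mat_vec odd_matrix (odd_features c)"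
  have "(c, ?v, ?w) \<in> set weighted_features"
    using assms by (auto simp: weighted_features_def)
  then have "pair_check d c ?v ?w (rotated_features d)"
    using all_checkD all_checked assms(4) by blast
  moreover have "(e, (rot7 ^^ d) (even_features e), (rot7 ^^ d) (odd_features e)) \<in> set (rotated_features d)"
    using assms by (auto simp: rotated_features_def)
  ultimately have *: "list_all (\<lambda>q. 2 * (dot ?v ((rot7 ^^ d) (even_features e)) + dot ?w ((rot7 ^^ d) (odd_features e))) \<le> 351232 * (2 * q - 9))
        (if d = 0 then [crossing_form 0 (1 # c @ [1]) (1 # e @ [1]), crossing_form 0 (1 # c @ [1]) (1 # e @ [- 1]),
                        crossing_form 0 (- 1 # c @ [1]) (1 # e @ [1]), crossing_form 0 (- 1 # c @ [1]) (1 # e @ [- 1])]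
         else [crossing_form d (1 # c @ [1]) (1 # e @ [1])])"
    by (rule pair_checkD)
  have "energy 0 c d e = dot ?v ((rot7 ^^ d) (even_features e)) + dot ?w ((rot7 ^^ d) (odd_features e))"
    using energy_swap[OF assms(1,2), of 0 d] by (simp add: energy_def dot_commute)
  with * have **: "list_all (\<lambda>q. 2 * energy 0 c d e \<le> 351232 * (2 * q - 9))
        (if d = 0 then [crossing_form 0 (1 # c @ [1]) (1 # e @ [1]), crossing_form 0 (1 # c @ [1]) (1 # e @ [- 1]),
                        crossing_form 0 (- 1 # c @ [1]) (1 # e @ [1]), crossing_form 0 (- 1 # c @ [1]) (1 # e @ [- 1])]
         else [crossing_form d (1 # c @ [1]) (1 # e @ [1])])"
    by simp
  show ?thesis
  proof (cases "d = 0")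
    case True
    then show ?thesis
      using ** assms(3) crossing_form_core(1)[OF assms(1,2), of x x' z z'] by auto
  next
    case False
    then have "d \<in> {1, 2, 3}" using assms(4) by auto
    then show ?thesis
      using ** False crossing_form_core(2)[OF assms(1,2), of d x x' z z'] by simp
  qed
qed

text \<open>Rotation brings the first gap to 0. If the difference d exceeds 3, the circle is read
  from the second red vertex instead, from which the first one is at difference 7 - d.\<close>

lemma energy_le:
  assumes "c \<in> set sign_lists" "e \<in> set sign_lists" "{x, x', z, z'} \<subseteq> {1, - 1}" "p \<le> q" "q \<le> 7"
  shows "2 * energy p c q e \<le> 351232 * (2 * crossing_form (q - p) (x # c @ [x']) (z # e @ [z']) - 9)"
proof (cases "q - p \<le> 3")
  case True
  have "energy p c q e = energy 0 c (q - p) e"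
    using energy_shift[OF assms(1,2), of p 0 "q - p"] assms by simp
  then show ?thesis using energy_le_small[OF assms(1-3) True] by simp
next
  case False
  define d where "d = q - p"
  have d: "d \<le> 7" "7 - d \<le> 3" using False assms by (auto simp: d_def)
  have "energy p c q e = energy 0 c d e"
    using energy_shift[OF assms(1,2), of p 0 d] assms by (simp add: d_def)
  \<comment> \<open>Rotate on until the second red vertex reaches gap 7, which is gap 0
    again.\<close>
  also have "\<dots> = energy (7 - d) c 7 e"
    using energy_shift[OF assms(1,2), of "7 - d" 0 d] d by simp
  also have "\<dots> = energy 0 e (7 - d) c"
    using energy_swap[OF assms(1,2)] by (simp add: energy_7)
  finally have "energy p c q e = energy 0 e (7 - d) c" .
  then show ?thesis
    using energy_le_small[OF assms(2,1) _ d(2), of z z' x x'] assms(3)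
      crossing_form_swap[OF d(1), of "z # e @ [z']" "x # c @ [x']"]
    by (simp add: d_def insert_commute)
qed

text \<open>By bilinearity the sum is the value of the two quadratic forms at the sum of all feature
  vectors.\<close>

lemma energy_nonneg:
  assumes "\<And>j. j < n \<Longrightarrow> c j \<in> set sign_lists"
  shows "0 \<le> (\<Sum>j<n. \<Sum>k<n. energy (p j) (c j) (p k) (c k))"
proof -
  have nonneg: "0 \<le> (\<Sum>j<n. \<Sum>k<n. dot (F j) (mat_vec M (F k)))"
    if F: "\<And>j. j < n \<Longrightarrow> length (F j) = N" and M: "length M = N" "\<forall>r\<in>set M. length r = N"
      and psd: "\<And>x :: nat \<Rightarrow> int. 0 \<le> (\<Sum>a<N. \<Sum>b<N. M ! a ! b * x a * x b)" for F M N
  proof -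
    have "(\<Sum>j<n. \<Sum>k<n. dot (F j) (mat_vec M (F k))) =
        (\<Sum>j<n. \<Sum>k<n. \<Sum>a<N. \<Sum>b<N. M ! a ! b * F j ! a * F k ! b)"
      using F M by (intro sum.cong refl dot_mat_vec) auto
    also have "\<dots> = (\<Sum>a<N. \<Sum>b<N. \<Sum>j<n. \<Sum>k<n. M ! a ! b * F j ! a * F k ! b)"
      by (simp only: sum.swap[of _ "{..<N}" "{..<n}"])
    also have "\<dots> = (\<Sum>a<N. \<Sum>b<N. M ! a ! b * (\<Sum>j<n. F j ! a) * (\<Sum>k<n. F k ! b))"
      by (intro sum.cong refl) (simp only: mult.assoc sum_product, simp only: sum_distrib_left)
    finally show ?thesis using psd by simp
  qed
  have "0 \<le> (\<Sum>a<49. \<Sum>b<49. even_matrix ! a ! b * x a * x b)" for x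
    using factor_dims weights_dims
    by (intro certified_nonneg[OF _ _ _ _ _ matrix_transpose(1) _ _ even_dominant] even_matrix_dims dims_ball)
       (simp_all add: list_all_iff)
  then have E: "0 \<le> (\<Sum>j<n. \<Sum>k<n. dot ((rot7 ^^ p j) (even_features (c j)))
      (mat_vec even_matrix ((rot7 ^^ p k) (even_features (c k)))))"
    using assms by (intro nonneg[of _ 49]) (simp_all add: even_matrix_dims dims_ball)
  have "0 \<le> (\<Sum>a<56. \<Sum>b<56. odd_matrix ! a ! b * x a * x b)" for x
    using factor_dims weights_dims
    by (intro certified_nonneg[OF _ _ _ _ _ matrix_transpose(2) _ _ odd_dominant] odd_matrix_dims dims_ball)
       (simp_all add: list_all_iff)
  then have "0 \<le> (\<Sum>j<n. \<Sum>k<n. dot ((rot7 ^^ p j) (odd_features (c j)))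
      (mat_vec odd_matrix ((rot7 ^^ p k) (odd_features (c k)))))"
    using assms by (intro nonneg[of _ 56]) (simp_all add: odd_matrix_dims dims_ball)
  with E show ?thesis by (simp add: energy_def sum.distrib)
qed

lemma sum_square_split:
  fixes f :: "nat \<Rightarrow> nat \<Rightarrow> int"
  assumes "\<And>j k. j < n \<Longrightarrow> k < n \<Longrightarrow> f j k = f k j"
  shows "(\<Sum>j<n. \<Sum>k<n. f j k) = 2 * (\<Sum>k<n. \<Sum>j<k. f j k) + (\<Sum>j<n. f j j)"
  using assms
proof (induction n)
  case (Suc n)
  have "(\<Sum>k<n. f n k) = (\<Sum>j<n. f j n)" using Suc.prems by (intro sum.cong) auto
  then show ?case using Suc by (simp add: sum.distrib)
qed simp

lemma crossing_form_sum_ge: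
  assumes gaps: "\<And>j. j < n \<Longrightarrow> p j \<le> 7" "\<And>j k. j < k \<Longrightarrow> k < n \<Longrightarrow> p j \<le> p k"
    and colours: "\<And>j. j < n \<Longrightarrow> length (c j) = 7" "\<And>j. j < n \<Longrightarrow> set (c j) \<subseteq> {1, - 1}"
  shows "9 * (int n)\<^sup>2 - 98 * int n \<le> 4 * (\<Sum>k<n. \<Sum>j<k. crossing_form (p k - p j) (c j) (c k))"
proof -
  \<comment> \<open>The five inner colours, without those of the edges to the two blue
    neighbours.\<close>
  define u where "u j = take 5 (tl (c j))" for j
  have split: "\<exists>x x'. {x, x'} \<subseteq> {1, - 1} \<and> c j = x # u j @ [x'] \<and> u j \<in> set sign_lists" if j: "j < n" for j
  proof -
    obtain x1 x2 x3 x4 x5 x6 x7 where "c j = [x1, x2, x3, x4, x5, x6, x7]"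
      using colours(1)[OF j] by (auto simp: length_Suc_conv numeral_eq_Suc)
    then show ?thesis using colours(2)[OF j] by (auto simp: u_def sign_lists_iff)
  qed
  have sign: "u j \<in> set sign_lists" if "j < n" for j using split[OF that] by blast
  define E where "E j k = energy (p j) (u j) (p k) (u k)" for j k
  have le: "2 * E j k \<le> 351232 * (2 * crossing_form (p k - p j) (c j) (c k) - 9)"
    if "j \<le> k" "k < n" for j k
  proof -
    have "j < n" using that by simp
    from split[OF this] obtain x x' where x: "{x, x'} \<subseteq> {1, - 1}" "c j = x # u j @ [x']" by blast
    from split[OF \<open>k < n\<close>] obtain z z' where z: "{z, z'} \<subseteq> {1, - 1}" "c k = z # u k @ [z']" by blast
    have "p j \<le> p k" using gaps(2)[of j k] that by (cases "j = k") auto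
    then show ?thesis unfolding E_def x(2) z(2)
      using x(1) z(1) that sign gaps(1) by (intro energy_le) auto
  qed
  have "0 \<le> (\<Sum>j<n. \<Sum>k<n. E j k)" unfolding E_def using sign by (rule energy_nonneg)
  also have "\<dots> = 2 * (\<Sum>k<n. \<Sum>j<k. E j k) + (\<Sum>j<n. E j j)"
    by (rule sum_square_split) (simp add: E_def energy_swap sign)
  finally have "0 \<le> 2 * (2 * (\<Sum>k<n. \<Sum>j<k. E j k)) + 2 * (\<Sum>j<n. E j j)" by simp
  \<comment> \<open>89 = 2 * 49 - 9, from the crude bound for a red vertex paired with
    itself.\<close>
  also have "2 * (\<Sum>j<n. E j j) \<le> (\<Sum>j<n. 351232 * 89)"
    unfolding sum_distrib_left
  proof (rule sum_mono)
    fix j assume "j \<in> {..<n}"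
    then show "2 * E j j \<le> 351232 * 89"
      using le[of j j] crossing_form_self[of "c j"] colours(1)[of j] by simp
  qed
  also have "2 * (\<Sum>k<n. \<Sum>j<k. E j k) \<le>
      (\<Sum>k<n. \<Sum>j<k. 351232 * (2 * crossing_form (p k - p j) (c j) (c k) - 9))"
    unfolding sum_distrib_left by (intro sum_mono le) auto
  also have "\<dots> = 351232 * (2 * (\<Sum>k<n. \<Sum>j<k. crossing_form (p k - p j) (c j) (c k)) - 9 * (\<Sum>k<n. int k))"
    by (simp add: sum_distrib_left[symmetric] sum_distrib_right[symmetric] sum_subtractf)
  finally have "0 \<le> 2 * (2 * (\<Sum>k<n. \<Sum>j<k. crossing_form (p k - p j) (c j) (c k)) - 9 * (\<Sum>k<n. int k)) + 89 * int n"
    by simp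
  \<comment> \<open>Passing from n^2 - n to n^2 costs another 9 n, which together with 89 n gives 98
    n.\<close>
  moreover have "2 * (\<Sum>k<n. int k) = int n * int n - int n"
    by (induction n) (simp_all add: algebra_simps)
  ultimately show ?thesis by (simp add: power2_eq_square)
qed

section \<open>Counting interlacing pairs of edges\<close>

lemma increasing_enumeration:
  fixes f :: "'a \<Rightarrow> real"
  assumes "finite A" "inj_on f A"
  obtains \<pi> where "bij_betw \<pi> {..<card A} A" "\<And>i j. i < j \<Longrightarrow> j < card A \<Longrightarrow> f (\<pi> i) < f (\<pi> j)"
proof
  define xs where "xs = sorted_list_of_set (f ` A)"
  have xs: "length xs = card A" "set xs = f ` A" "distinct xs" "sorted_wrt (<) xs"
    using assms by (simp_all add: xs_def card_image)
  define \<pi> where "\<pi> i = the_inv_into A f (xs ! i)" for i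
  have f\<pi>: "f (\<pi> i) = xs ! i" if "i < card A" for i
    unfolding \<pi>_def using that xs assms by (intro f_the_inv_into_f) (metis nth_mem)+
  have "bij_betw ((!) xs) {..<card A} (f ` A)" using xs by (intro bij_betw_nth) auto
  moreover have "bij_betw (the_inv_into A f) (f ` A) A"
    using assms by (intro bij_betw_the_inv_into) (simp add: bij_betw_def)
  ultimately have "bij_betw (the_inv_into A f \<circ> (!) xs) {..<card A} A" by (rule bij_betw_trans)
  moreover have "\<pi> = the_inv_into A f \<circ> (!) xs" by (auto simp: \<pi>_def)
  ultimately show "bij_betw \<pi> {..<card A} A" by simp
  show "f (\<pi> i) < f (\<pi> j)" if "i < j" "j < card A" for i j
    using that xs f\<pi> by (simp add: sorted_wrt_nth_less)
qed

lemma downward_closed_eq_lessThan: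
  fixes S :: "nat set"
  assumes "finite S" "\<And>a b. a \<in> S \<Longrightarrow> b < a \<Longrightarrow> b \<in> S"
  shows "S = {..<card S}"
proof (cases "S = {}")
  case False
  have "x \<in> S" if "x \<le> Max S" for x
    using that assms(2)[of "Max S" x] Max_in[OF assms(1) False] by (cases "x = Max S") auto
  then have "S = {..Max S}" using assms(1) by auto
  then show ?thesis by (metis card_atMost lessThan_Suc_atMost)
qed simp

definition chords_cross :: "real \<Rightarrow> real \<Rightarrow> real \<Rightarrow> real \<Rightarrow> bool" where
  "chords_cross x y u v \<longleftrightarrow>
     min x y < min u v \<and> min u v < max x y \<and> max x y < max u v \<or>
     min u v < min x y \<and> min x y < max u v \<and> max u v < max x y"

text \<open>Bare positions and a page predicate, so that it applies to any set of blue vertices of a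
  drawing. The condition \<open>r j < r k\<close> lists each pair of edges once.\<close>

definition crossing_quadruples ::
  "(nat \<Rightarrow> real) \<Rightarrow> (nat \<Rightarrow> real) \<Rightarrow> (nat \<Rightarrow> nat \<Rightarrow> bool) \<Rightarrow> nat set \<Rightarrow> nat \<Rightarrow> (nat \<times> nat \<times> nat \<times> nat) set" where
  "crossing_quadruples b r side B n =
     {(j, k, a, a'). j < n \<and> k < n \<and> r j < r k \<and> a \<in> B \<and> a' \<in> B \<and> side a j = side a' k \<and>
        chords_cross (r j) (b a) (r k) (b a')}"

lemma finite_crossing_quadruples: "finite B \<Longrightarrow> finite (crossing_quadruples b r side B n)"
  by (rule finite_subset[of _ "{..<n} \<times> {..<n} \<times> B \<times> B"]) (auto simp: crossing_quadruples_def)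

text \<open>Numbering the red vertices from left to right makes their gaps monotone, as
  \<open>crossing_form_sum_ge\<close> requires; numbering the blue ones likewise makes a gap the
  number of blue vertices to its left.\<close>

lemma crossing_quadruples_card_ge:
  assumes B: "finite B" "card B = 7" and inj: "inj_on b B" "inj_on r {..<n}"
    and disj: "b ` B \<inter> r ` {..<n} = {}"
  shows "9 * (int n)\<^sup>2 - 98 * int n \<le> 4 * int (card (crossing_quadruples b r side B n))"
proof -
  obtain \<pi> where \<pi>: "bij_betw \<pi> {..<n} {..<n}" "\<And>i j. i < j \<Longrightarrow> j < n \<Longrightarrow> r (\<pi> i) < r (\<pi> j)"
    using increasing_enumeration[of "{..<n}" r] inj by auto
  obtain \<rho> :: "nat \<Rightarrow> nat" where \<rho>: "bij_betw \<rho> {..<7} B" "\<And>i j. i < j \<Longrightarrow> j < 7 \<Longrightarrow> b (\<rho> i) < b (\<rho> j)"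
    using increasing_enumeration[OF B(1) inj(1)] B(2) by auto
  define p where "p k = card {a. a < 7 \<and> b (\<rho> a) < r (\<pi> k)}" for k
  have p_le: "p k \<le> 7" for k
    unfolding p_def using card_mono[of "{..<7}" "{a. a < 7 \<and> b (\<rho> a) < r (\<pi> k)}"] by auto
  \<comment> \<open>The blue indices to the left of a red vertex form an initial segment, so
    comparing an index with the gap amounts to comparing positions.\<close>
  have "{a. a < 7 \<and> b (\<rho> a) < r (\<pi> k)} = {..<p k}" for k
    unfolding p_def using \<rho>(2) by (intro downward_closed_eq_lessThan) (auto, meson less_trans)
  then have p_iff: "a < p k \<longleftrightarrow> b (\<rho> a) < r (\<pi> k)" if "a < 7" for a k
    using that by (auto simp: set_eq_iff)
  have p_mono: "p j \<le> p k" if "j < k" "k < n" for j k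
    unfolding p_def using \<pi>(2)[OF that] by (intro card_mono) auto
  define col where "col k a = (if side (\<rho> a) (\<pi> k) then 1 else - 1 :: int)" for k a
  define I where "I = {(j, k, a, a'). j < k \<and> k < n \<and> a < 7 \<and> a' < 7 \<and>
    interleaved (p j) (p k) a a' \<and> col j a = col k a'}"
  have length: "length (relative q c) = 7" for q c
    by (induction q) (simp_all add: relative_def cyclic_order_def)
  have "9 * (int n)\<^sup>2 - 98 * int n \<le>
      4 * (\<Sum>k<n. \<Sum>j<k. crossing_form (p k - p j) (relative (p j) (col j)) (relative (p k) (col k)))"
    by (rule crossing_form_sum_ge) (auto simp: p_le p_mono length, auto simp: relative_def col_def split: if_splits)
  also have "(\<Sum>k<n. \<Sum>j<k. crossing_form (p k - p j) (relative (p j) (col j)) (relative (p k) (col k))) =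
      (\<Sum>k<n. \<Sum>j<k. \<Sum>a<7. \<Sum>a'<7. of_bool (interleaved (p j) (p k) a a' \<and> col j a = col k a'))"
    by (intro sum.cong refl crossing_form_relative) (auto simp: p_le p_mono)
  also have "\<dots> = (\<Sum>k<n. \<Sum>j<n. \<Sum>a<7. \<Sum>a'<7. of_bool (j < k \<and> interleaved (p j) (p k) a a' \<and> col j a = col k a'))"
    by (intro sum.cong refl sum.mono_neutral_cong_left) auto
  also have "\<dots> = (\<Sum>(k, j, a, a')\<in>{..<n} \<times> {..<n} \<times> {..<7} \<times> {..<7}.
      of_bool (j < k \<and> interleaved (p j) (p k) a a' \<and> col j a = col k a'))"
    by (simp only: sum.cartesian_product)
  also have "\<dots> = int (card (({..<n} \<times> {..<n} \<times> {..<7} \<times> {..<7}) \<inter>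
      {(k, j, a, a'). j < k \<and> interleaved (p j) (p k) a a' \<and> col j a = col k a'}))"
    by (simp add: case_prod_unfold)
  also have "\<dots> = int (card I)"
    by (intro arg_cong[of _ _ int] bij_betw_same_card[of "\<lambda>(k, j, a, a'). (j, k, a, a')"]
        bij_betw_byWitness[of _ "\<lambda>(k, j, a, a'). (j, k, a, a')"]) (auto simp: I_def)
  also have "card I \<le> card (crossing_quadruples b r side B n)"
  proof (rule card_inj_on_le[of "\<lambda>(j, k, a, a'). (\<pi> j, \<pi> k, \<rho> a, \<rho> a')"])
    have "inj_on \<pi> {..<n}" "inj_on \<rho> {..<7}" using \<pi>(1) \<rho>(1) by (auto simp: bij_betw_def)
    then show "inj_on (\<lambda>(j, k, a, a'). (\<pi> j, \<pi> k, \<rho> a, \<rho> a')) I"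
      by (auto simp: inj_on_def I_def)
    show "finite (crossing_quadruples b r side B n)" using B by (simp add: finite_crossing_quadruples)
    show "(\<lambda>(j, k, a, a'). (\<pi> j, \<pi> k, \<rho> a, \<rho> a')) ` I \<subseteq> crossing_quadruples b r side B n"
    proof clarify
      fix j k a a' assume "(j, k, a, a') \<in> I"
      then have I: "j < k" "k < n" "a < 7" "a' < 7" "interleaved (p j) (p k) a a'" "col j a = col k a'"
        by (auto simp: I_def)
      have mem: "\<pi> j < n" "\<pi> k < n" "\<rho> a \<in> B" "\<rho> a' \<in> B"
        using bij_betwE[OF \<pi>(1)] bij_betwE[OF \<rho>(1)] I by auto
      have ne: "b (\<rho> x) \<noteq> r (\<pi> y)" if "x < 7" "y < n" for x y
        using disj bij_betwE[OF \<pi>(1)] bij_betwE[OF \<rho>(1)] that by blast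
      have less: "x < y \<longleftrightarrow> b (\<rho> x) < b (\<rho> y)" if "x < 7" "y < 7" for x y
        using \<rho>(2) that by (metis less_asym linorder_neqE_nat order_less_irrefl)
      have "r (\<pi> j) < r (\<pi> k)" using \<pi>(2) I by simp
      moreover have "a < p j \<longleftrightarrow> b (\<rho> a) < r (\<pi> j)" "a < p k \<longleftrightarrow> b (\<rho> a) < r (\<pi> k)"
        "a' < p j \<longleftrightarrow> b (\<rho> a') < r (\<pi> j)" "a' < p k \<longleftrightarrow> b (\<rho> a') < r (\<pi> k)"
        "a < a' \<longleftrightarrow> b (\<rho> a) < b (\<rho> a')" "a' < a \<longleftrightarrow> b (\<rho> a') < b (\<rho> a)"
        using I p_iff less by auto
      moreover have "b (\<rho> a) \<noteq> r (\<pi> j)" "b (\<rho> a) \<noteq> r (\<pi> k)" "b (\<rho> a') \<noteq> r (\<pi> j)" "b (\<rho> a') \<noteq> r (\<pi> k)"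
        using ne I by auto
      \<comment> \<open>Both notions of interlacing are Boolean combinations of the comparisons just
        collected.\<close>
      ultimately have "chords_cross (r (\<pi> j)) (b (\<rho> a)) (r (\<pi> k)) (b (\<rho> a'))"
        using I(5) unfolding interleaved_def chords_cross_def not_less[symmetric] min_def max_def
        by (smt (verit))
      moreover have "side (\<rho> a) (\<pi> j) = side (\<rho> a') (\<pi> k)"
        using I(6) by (auto simp: col_def split: if_splits)
      ultimately show "(\<pi> j, \<pi> k, \<rho> a, \<rho> a') \<in> crossing_quadruples b r side B n"
        using mem \<open>r (\<pi> j) < r (\<pi> k)\<close> by (simp add: crossing_quadruples_def)
    qed
  qed
  finally show ?thesis by simp
qed

section \<open>Lower bound for drawings\<close>

text \<open>Inner product with the normal turned by a right angle: a coordinate along the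
  spine.\<close>

definition spine_coordinate :: "real ^ 2 \<Rightarrow> real ^ 2 \<Rightarrow> real" where
  "spine_coordinate a x = a $ 1 * x $ 2 - a $ 2 * x $ 1"

lemma inner_2: "(a :: real ^ 2) \<bullet> x = a $ 1 * x $ 1 + a $ 2 * x $ 2"
  by (simp add: inner_vec_def sum_2)

lemma spine_coordinate_inj:
  assumes "a \<noteq> 0" "a \<bullet> x = a \<bullet> y" "spine_coordinate a x = spine_coordinate a y"
  shows "x = y"
proof -
  let ?u = "x $ 1 - y $ 1" and ?v = "x $ 2 - y $ 2"
  have 1: "a $ 1 * ?u + a $ 2 * ?v = 0" and 2: "a $ 1 * ?v - a $ 2 * ?u = 0"
    using assms by (simp_all add: inner_2 spine_coordinate_def algebra_simps)
  \<comment> \<open>Combinations that isolate each coordinate difference with the factor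
    |a|^2.\<close>
  have "a $ 1 * (a $ 1 * ?u + a $ 2 * ?v) - a $ 2 * (a $ 1 * ?v - a $ 2 * ?u) = 0"
    "a $ 2 * (a $ 1 * ?u + a $ 2 * ?v) + a $ 1 * (a $ 1 * ?v - a $ 2 * ?u) = 0"
    by (simp_all add: 1 2)
  then have "((a $ 1)\<^sup>2 + (a $ 2)\<^sup>2) * ?u = 0" "((a $ 1)\<^sup>2 + (a $ 2)\<^sup>2) * ?v = 0"
    by (simp_all add: power2_eq_square algebra_simps)
  moreover have "(a $ 1)\<^sup>2 + (a $ 2)\<^sup>2 \<noteq> 0"
    using assms(1) by (simp add: vec_eq_iff forall_2 sum_power2_eq_zero_iff)
  ultimately show ?thesis by (auto simp: vec_eq_iff forall_2)
qed

text \<open>In coordinates along and across the spine, with \<open>s\<close> turning the page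
  upwards, this is the Fashoda theorem for four ends that alternate on the bottom edge of a
  box.\<close>

lemma same_side_interlace:
  fixes f g :: "real \<Rightarrow> real ^ 2" and s :: real
  assumes "a \<noteq> 0" "s \<noteq> 0" "path f" "path g"
    and side: "\<And>x. x \<in> path_image f \<union> path_image g \<Longrightarrow> 0 \<le> s * (a \<bullet> x - b)"
    and spine: "\<And>x. x \<in> {pathstart f, pathfinish f, pathstart g, pathfinish g} \<Longrightarrow> a \<bullet> x = b"
    and order: "spine_coordinate a (pathstart f) < spine_coordinate a (pathstart g)"
      "spine_coordinate a (pathstart g) < spine_coordinate a (pathfinish f)"
      "spine_coordinate a (pathfinish f) < spine_coordinate a (pathfinish g)"
  shows "path_image f \<inter> path_image g \<noteq> {}"
proof -
  define T :: "real ^ 2 \<Rightarrow> real ^ 2" where "T x = (\<chi> i. if i = 1 then spine_coordinate a x else s * (a \<bullet> x - b))" for x :: "real ^ 2"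
  have T1: "T x $ 1 = spine_coordinate a x" and T2: "T x $ 2 = s * (a \<bullet> x - b)" for x
    by (simp_all add: T_def)
  have "continuous_on UNIV T"
    unfolding T_def spine_coordinate_def
  proof (rule continuous_on_vec_lambda)
    show "continuous_on UNIV (\<lambda>x. if i = 1 then a $ 1 * x $ 2 - a $ 2 * x $ 1 else s * (a \<bullet> x - b))" for i :: 2
      by (cases "i = 1") (auto simp: inner_2 intro!: continuous_intros)
  qed
  then have cont: "continuous_on S T" for S by (rule continuous_on_subset) simp
  have paths: "path (T \<circ> f)" "path (T \<circ> g)"
    using assms cont by (auto intro: path_continuous_image)
  have images: "path_image (T \<circ> f) = T ` path_image f" "path_image (T \<circ> g) = T ` path_image g"
    by (simp_all add: path_image_compose)
  have "bounded (path_image (T \<circ> f) \<union> path_image (T \<circ> g))"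
    using paths by (simp add: bounded_path_image)
  then obtain B where B: "\<And>z. z \<in> path_image (T \<circ> f) \<union> path_image (T \<circ> g) \<Longrightarrow> norm z \<le> B"
    by (meson bounded_iff)
  \<comment> \<open>The bottom edge has height 0, the image of the spine, so the ends of both paths
    lie on it.\<close>
  define l u :: "real ^ 2" where "l = (\<chi> i. if i = 1 then - B else 0)" and "u = (\<chi> i. B)"
  have box: "path_image (T \<circ> f) \<union> path_image (T \<circ> g) \<subseteq> cbox l u"
  proof
    fix z assume z: "z \<in> path_image (T \<circ> f) \<union> path_image (T \<circ> g)"
    then have "0 \<le> z $ 2" using side by (auto simp: images T2)
    moreover have "\<bar>z $ i\<bar> \<le> B" for i using B[OF z] component_le_norm_cart[of z i] by linarith
    ultimately show "z \<in> cbox l u"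
      unfolding mem_box_cart forall_2 by (auto simp: l_def u_def abs_le_iff) (meson abs_le_iff minus_le_iff)+
  qed
  have ends: "pathstart (T \<circ> h) = T (pathstart h)" "pathfinish (T \<circ> h) = T (pathfinish h)" for h
    by (simp_all add: pathstart_compose pathfinish_compose)
  obtain z where "z \<in> path_image (T \<circ> f)" "z \<in> path_image (T \<circ> g)"
  proof (rule fashoda_interlace[OF paths, of l u])
    show "path_image (T \<circ> f) \<subseteq> cbox l u" "path_image (T \<circ> g) \<subseteq> cbox l u" using box by auto
  qed (use spine order in \<open>simp_all add: ends T1 T2 l_def\<close>)
  then obtain x y where xy: "x \<in> path_image f" "y \<in> path_image g" "T x = T y"
    by (auto simp: images)
  have "x = y"
    using xy(3) assms(2) T1[of x] T1[of y] T2[of x] T2[of y]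
    by (intro spine_coordinate_inj[OF assms(1)]) (auto simp: )
  then show ?thesis using xy by auto
qed

text \<open>The ends of an edge are unordered, so each curve is reversed if necessary to run along
  increasing spine coordinate; the two ways to interlace exchange \<open>f\<close> and
  \<open>g\<close>.\<close>

lemma same_side_chords_meet:
  fixes f g :: "real \<Rightarrow> real ^ 2" and s :: real
  assumes "a \<noteq> 0" "s \<noteq> 0" "path f" "path g"
    and side: "\<And>x. x \<in> path_image f \<union> path_image g \<Longrightarrow> 0 \<le> s * (a \<bullet> x - b)"
    and spine: "a \<bullet> P = b" "a \<bullet> Q = b" "a \<bullet> U = b" "a \<bullet> W = b"
    and ends: "{pathstart f, pathfinish f} = {P, Q}" "{pathstart g, pathfinish g} = {U, W}"
    and cross: "chords_cross (spine_coordinate a P) (spine_coordinate a Q) (spine_coordinate a U) (spine_coordinate a W)"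
  shows "path_image f \<inter> path_image g \<noteq> {}"
proof -
  let ?h = "spine_coordinate a"
  have orient: "\<exists>f'. path f' \<and> path_image f' = path_image f \<and> {pathstart f', pathfinish f'} = {P, Q} \<and>
      ?h (pathstart f') = min (?h P) (?h Q) \<and> ?h (pathfinish f') = max (?h P) (?h Q)"
    if "path f" "{pathstart f, pathfinish f} = {P, Q}" for f P Q
  proof (cases "?h (pathstart f) \<le> ?h (pathfinish f)")
    case True
    then show ?thesis using that by (intro exI[of _ f]) (auto simp: doubleton_eq_iff min_def max_def)
  next
    case False
    then show ?thesis using that
      by (intro exI[of _ "reversepath f"]) (auto simp: doubleton_eq_iff min_def max_def)
  qed
  obtain f' where f': "path f'" "path_image f' = path_image f" "{pathstart f', pathfinish f'} = {P, Q}"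
      "?h (pathstart f') = min (?h P) (?h Q)" "?h (pathfinish f') = max (?h P) (?h Q)"
    using orient[OF assms(3) ends(1)] by blast
  obtain g' where g': "path g'" "path_image g' = path_image g" "{pathstart g', pathfinish g'} = {U, W}"
      "?h (pathstart g') = min (?h U) (?h W)" "?h (pathfinish g') = max (?h U) (?h W)"
    using orient[OF assms(4) ends(2)] by blast
  have sp: "a \<bullet> x = b" if "x \<in> {pathstart f', pathfinish f', pathstart g', pathfinish g'}" for x
    using that f'(3) g'(3) spine by (metis insertE insertI1 insert_commute singletonD)
  from cross show ?thesis unfolding chords_cross_def
  proof (elim disjE conjE)
    assume "min (?h P) (?h Q) < min (?h U) (?h W)" "min (?h U) (?h W) < max (?h P) (?h Q)"
      "max (?h P) (?h Q) < max (?h U) (?h W)"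
    then have "path_image f' \<inter> path_image g' \<noteq> {}"
      using side sp by (intro same_side_interlace[OF assms(1,2) f'(1) g'(1)]) (simp_all only: f' g')
    then show ?thesis using f' g' by simp
  next
    assume "min (?h U) (?h W) < min (?h P) (?h Q)" "min (?h P) (?h Q) < max (?h U) (?h W)"
      "max (?h U) (?h W) < max (?h P) (?h Q)"
    moreover have "a \<bullet> x = b" if "x \<in> {pathstart g', pathfinish g', pathstart f', pathfinish f'}" for x
      using sp that by blast
    ultimately have "path_image g' \<inter> path_image f' \<noteq> {}"
      using side by (intro same_side_interlace[OF assms(1,2) g'(1) f'(1)]) (simp_all only: f' g' Un_commute)
    then show ?thesis using f' g' by auto
  qed
qed

section \<open>Interlacing quadruples in a drawing of a complete bipartite graph\<close>

definition edge :: "nat \<Rightarrow> nat \<Rightarrow> (nat + nat) set" where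
  "edge i j = {Inl i, Inr j}"

lemma edge_eq_iff [simp]: "edge i j = edge i' j' \<longleftrightarrow> i = i' \<and> j = j'"
  by (auto simp: edge_def doubleton_eq_iff)

lemma edges_complete_bipartite: "edges (complete_bipartite m n) = {edge i j | i j. i < m \<and> j < n}"
  by (simp add: complete_bipartite_def edge_def)

lemma vertices_complete_bipartite:
  "Inl i \<in> vertices (complete_bipartite m n) \<longleftrightarrow> i < m"
  "Inr j \<in> vertices (complete_bipartite m n) \<longleftrightarrow> j < n"
  by (auto simp: complete_bipartite_def)

definition drawing_quadruples ::
  "(nat + nat) spine_drawing \<Rightarrow> nat set \<Rightarrow> nat \<Rightarrow> (nat \<times> nat \<times> nat \<times> nat) set" where
  "drawing_quadruples D =
     crossing_quadruples (\<lambda>i. spine_coordinate (normal D) (pos D (Inl i)))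
       (\<lambda>j. spine_coordinate (normal D) (pos D (Inr j)))
       (\<lambda>i j. curve D (edge i j) ` {0<..<1} \<subseteq> upper_page D)"

context
  fixes D :: "(nat + nat) spine_drawing" and m n :: nat
  assumes drawing: "two_page_drawing (complete_bipartite m n) D"
begin

lemma normal_nonzero: "normal D \<noteq> 0"
  using drawing by (simp add: two_page_drawing_def)

lemma pos_on_spine: "v \<in> vertices (complete_bipartite m n) \<Longrightarrow> normal D \<bullet> pos D v = offset D"
  using drawing by (auto simp: two_page_drawing_def spine_def)

lemma coordinate_inj:
  assumes "v \<in> vertices (complete_bipartite m n)" "w \<in> vertices (complete_bipartite m n)"
    "spine_coordinate (normal D) (pos D v) = spine_coordinate (normal D) (pos D w)"
  shows "v = w"
proof -
  have "pos D v = pos D w"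
    using assms pos_on_spine normal_nonzero by (intro spine_coordinate_inj) auto
  then show ?thesis using drawing assms by (auto simp: two_page_drawing_def inj_on_def)
qed

lemma edge_curve:
  assumes "i < m" "j < n"
  shows "path (curve D (edge i j))"
    and "{pathstart (curve D (edge i j)), pathfinish (curve D (edge i j))} = {pos D (Inl i), pos D (Inr j)}"
    and "curve D (edge i j) ` {0<..<1} \<subseteq> lower_page D \<or> curve D (edge i j) ` {0<..<1} \<subseteq> upper_page D"
proof -
  have e: "edge i j \<in> edges (complete_bipartite m n)"
    using assms by (auto simp: edges_complete_bipartite)
  then show "path (curve D (edge i j))"
    using drawing by (auto simp: two_page_drawing_def arc_imp_path)
  have "pos D ` edge i j = {pos D (Inl i), pos D (Inr j)}" by (simp add: edge_def)
  then show "{pathstart (curve D (edge i j)), pathfinish (curve D (edge i j))} = {pos D (Inl i), pos D (Inr j)}"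
    using drawing e unfolding two_page_drawing_def by metis
  show "curve D (edge i j) ` {0<..<1} \<subseteq> lower_page D \<or> curve D (edge i j) ` {0<..<1} \<subseteq> upper_page D"
    using drawing e by (auto simp: two_page_drawing_def)
qed

lemma path_image_edge:
  assumes "i < m" "j < n"
  shows "path_image (curve D (edge i j)) =
    {pos D (Inl i), pos D (Inr j)} \<union> curve D (edge i j) ` {0<..<1}"
proof -
  have "{0..1::real} = {0, 1} \<union> {0<..<1}" by auto
  then have "path_image (curve D (edge i j)) = {curve D (edge i j) 0, curve D (edge i j) 1} \<union> curve D (edge i j) ` {0<..<1}"
    unfolding path_image_def by auto
  then show ?thesis using edge_curve(2)[OF assms] by (simp only: pathstart_def pathfinish_def)
qed

lemma quadruple_crossing:
  assumes "i < m" "i' < m" "j < n" "j' < n"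
    and same: "curve D (edge i j) ` {0<..<1} \<subseteq> upper_page D \<longleftrightarrow> curve D (edge i' j') ` {0<..<1} \<subseteq> upper_page D"
    and cross: "chords_cross (spine_coordinate (normal D) (pos D (Inr j))) (spine_coordinate (normal D) (pos D (Inl i)))
      (spine_coordinate (normal D) (pos D (Inr j'))) (spine_coordinate (normal D) (pos D (Inl i')))"
  shows "\<exists>z. ({edge i j, edge i' j'}, z) \<in> crossings (complete_bipartite m n) D"
proof -
  let ?f = "curve D (edge i j)" and ?g = "curve D (edge i' j')"
  let ?h = "\<lambda>v. spine_coordinate (normal D) (pos D v)"
  have verts: "Inl i \<in> vertices (complete_bipartite m n)" "Inl i' \<in> vertices (complete_bipartite m n)"
    "Inr j \<in> vertices (complete_bipartite m n)" "Inr j' \<in> vertices (complete_bipartite m n)"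
    using assms by (simp_all add: vertices_complete_bipartite)
  note sp = pos_on_spine[OF verts(1)] pos_on_spine[OF verts(2)] pos_on_spine[OF verts(3)] pos_on_spine[OF verts(4)]
  note f = edge_curve[OF assms(1,3)] and g = edge_curve[OF assms(2,4)]
  obtain s :: real where s: "s \<noteq> 0"
    "\<And>x. x \<in> ?f ` {0<..<1} \<union> ?g ` {0<..<1} \<Longrightarrow> 0 < s * (normal D \<bullet> x - offset D)"
  proof (cases "?f ` {0<..<1} \<subseteq> upper_page D")
    case True
    then show ?thesis using same by (intro that[of 1]) (auto simp: upper_page_def)
  next
    case False
    then show ?thesis using same f(3) g(3) by (intro that[of "- 1"]) (auto simp: lower_page_def)
  qed
  have images: "path_image ?f = {pos D (Inl i), pos D (Inr j)} \<union> ?f ` {0<..<1}"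
    "path_image ?g = {pos D (Inl i'), pos D (Inr j')} \<union> ?g ` {0<..<1}"
    using assms by (simp_all add: path_image_edge)
  have "path_image ?f \<inter> path_image ?g \<noteq> {}"
  proof (rule same_side_chords_meet[OF normal_nonzero s(1) f(1) g(1)])
    show "0 \<le> s * (normal D \<bullet> x - offset D)" if "x \<in> path_image ?f \<union> path_image ?g" for x
      using that s(2)[of x] sp by (auto simp: images)
    show "{pathstart ?f, pathfinish ?f} = {pos D (Inr j), pos D (Inl i)}"
      "{pathstart ?g, pathfinish ?g} = {pos D (Inr j'), pos D (Inl i')}"
      using f(2) g(2) by auto
  qed (use sp cross in simp_all)
  then obtain z where z: "z \<in> path_image ?f" "z \<in> path_image ?g" by auto
  \<comment> \<open>Vertices lie on the spine and the open curves do not, so a vertex in common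
    would be an end of both edges; interlacing chords share no end.\<close>
  have "z \<notin> pos D ` vertices (complete_bipartite m n)"
  proof
    assume "z \<in> pos D ` vertices (complete_bipartite m n)"
    then have "normal D \<bullet> z = offset D" using pos_on_spine by auto
    then have "z \<notin> ?f ` {0<..<1}" "z \<notin> ?g ` {0<..<1}" using s(2)[of z] by auto
    then have "z \<in> {pos D (Inl i), pos D (Inr j)} \<inter> {pos D (Inl i'), pos D (Inr j')}"
      using z images by auto
    then show False using cross by (auto simp: chords_cross_def min_def max_def split: if_splits)
  qed
  moreover have "edge i j \<noteq> edge i' j'" using cross by (auto simp: chords_cross_def)
  ultimately have "({edge i j, edge i' j'}, z) \<in> crossings (complete_bipartite m n) D"
    unfolding crossings_def edges_complete_bipartite using z assms by blast
  then show ?thesis by blast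
qed

text \<open>One crossing is chosen for every quadruple. The unordered pair of edges determines the
  quadruple, because the red vertex with the smaller coordinate comes first.\<close>

lemma card_drawing_quadruples_le:
  assumes fin: "finite (crossings (complete_bipartite m n) D)"
  shows "card (drawing_quadruples D {..<m} n) \<le> card (crossings (complete_bipartite m n) D)"
proof -
  let ?X = "drawing_quadruples D {..<m} n"
  have "\<exists>z. ({edge i j, edge i' j'}, z) \<in> crossings (complete_bipartite m n) D"
    if "(j, j', i, i') \<in> ?X" for i i' j j'
    using that unfolding drawing_quadruples_def crossing_quadruples_def
    by (intro quadruple_crossing) auto
  then obtain z where z: "\<And>i i' j j'. (j, j', i, i') \<in> ?X \<Longrightarrow>
      ({edge i j, edge i' j'}, z j j' i i') \<in> crossings (complete_bipartite m n) D"
    by metis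
  show ?thesis
  proof (rule card_inj_on_le[of "\<lambda>(j, j', i, i'). ({edge i j, edge i' j'}, z j j' i i')"])
    show "inj_on (\<lambda>(j, j', i, i'). ({edge i j, edge i' j'}, z j j' i i')) ?X"
      by (auto simp: inj_on_def doubleton_eq_iff drawing_quadruples_def crossing_quadruples_def)
  qed (use z fin in auto)
qed

text \<open>Any 7 of the m blue vertices are allowed, so deleting a blue vertex does not require a
  new drawing.\<close>

lemma drawing_quadruples_card_ge:
  assumes "B \<subseteq> {..<m}" "card B = 7"
  shows "9 * (int n)\<^sup>2 - 98 * int n \<le> 4 * int (card (drawing_quadruples D B n))"
  unfolding drawing_quadruples_def
proof (rule crossing_quadruples_card_ge)
  show "finite B" using assms(1) finite_subset by blast
  show "inj_on (\<lambda>i. spine_coordinate (normal D) (pos D (Inl i))) B"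
  proof (rule inj_onI)
    fix i i' assume "i \<in> B" "i' \<in> B"
      "spine_coordinate (normal D) (pos D (Inl i)) = spine_coordinate (normal D) (pos D (Inl i'))"
    then show "i = i'"
      using coordinate_inj[of "Inl i" "Inl i'"] assms(1) by (auto simp: vertices_complete_bipartite)
  qed
  show "inj_on (\<lambda>j. spine_coordinate (normal D) (pos D (Inr j))) {..<n}"
  proof (rule inj_onI)
    fix j j' assume "j \<in> {..<n}" "j' \<in> {..<n}"
      "spine_coordinate (normal D) (pos D (Inr j)) = spine_coordinate (normal D) (pos D (Inr j'))"
    then show "j = j'"
      using coordinate_inj[of "Inr j" "Inr j'"] by (auto simp: vertices_complete_bipartite)
  qed
  show "(\<lambda>i. spine_coordinate (normal D) (pos D (Inl i))) ` B \<inter>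
      (\<lambda>j. spine_coordinate (normal D) (pos D (Inr j))) ` {..<n} = {}"
  proof -
    have "spine_coordinate (normal D) (pos D (Inl i)) \<noteq> spine_coordinate (normal D) (pos D (Inr j))"
      if "i \<in> B" "j < n" for i j
      using coordinate_inj[of "Inl i" "Inr j"] assms(1) that by (auto simp: vertices_complete_bipartite)
    then show ?thesis by auto
  qed
qed (use assms in simp)

end

lemma crossings_ge_7:
  assumes "two_page_drawing (complete_bipartite 7 n) D" "finite (crossings (complete_bipartite 7 n) D)"
  shows "9 * (int n)\<^sup>2 - 98 * int n \<le> 4 * int (card (crossings (complete_bipartite 7 n) D))"
  using drawing_quadruples_card_ge[OF assms(1), of "{..<7}"] card_drawing_quadruples_le[OF assms] by simp

lemma crossings_ge_8:
  assumes "two_page_drawing (complete_bipartite 8 n) D" "finite (crossings (complete_bipartite 8 n) D)"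
  shows "36 * (int n)\<^sup>2 - 392 * int n \<le> 12 * int (card (crossings (complete_bipartite 8 n) D))"
proof -
  define X where "X B = drawing_quadruples D B n" for B
  have fin: "finite (X {..<8})"
    by (simp add: X_def drawing_quadruples_def finite_crossing_quadruples)
  have X: "X ({..<8} - {l}) = {x \<in> X {..<8}. case x of (j, j', i, i') \<Rightarrow> l \<noteq> i \<and> l \<noteq> i'}" for l
    by (auto simp: X_def drawing_quadruples_def crossing_quadruples_def)
  have "8 * (9 * (int n)\<^sup>2 - 98 * int n) = (\<Sum>l<8::nat. 9 * (int n)\<^sup>2 - 98 * int n)" by simp
  also have "\<dots> \<le> (\<Sum>l<8. 4 * int (card (X ({..<8} - {l}))))"
    unfolding X_def by (intro sum_mono drawing_quadruples_card_ge[OF assms(1)]) auto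
  also have "\<dots> = 4 * int (\<Sum>l<8. card {x \<in> X {..<8}. case x of (j, j', i, i') \<Rightarrow> l \<noteq> i \<and> l \<noteq> i'})"
    by (simp add: X sum_distrib_left)
  \<comment> \<open>Double counting, by quadruples instead of deleted vertices. The outcome, 8 (9
    n^2 - 98 n) against 4 * 6 crossings, is stated divided by 2.\<close>
  also have "(\<Sum>l<8. card {x \<in> X {..<8}. case x of (j, j', i, i') \<Rightarrow> l \<noteq> i \<and> l \<noteq> i'}) =
      (\<Sum>x\<in>X {..<8}. card {l \<in> {..<8}. case x of (j, j', i, i') \<Rightarrow> l \<noteq> i \<and> l \<noteq> i'})"
    using fin by (intro sum_multicount_gen) auto
  also have "\<dots> = (\<Sum>x\<in>X {..<8}. 6)"
  proof (rule sum.cong[OF refl])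
    fix x assume x: "x \<in> X {..<8}"
    obtain j j' i i' where eq: "x = (j, j', i, i')" by (cases x)
    have "i < 8" "i' < 8" "i \<noteq> i'"
      using x by (auto simp: eq X_def drawing_quadruples_def crossing_quadruples_def chords_cross_def)
    moreover have "{l \<in> {..<8}. case x of (j, j', i, i') \<Rightarrow> l \<noteq> i \<and> l \<noteq> i'} = {..<8} - {i, i'}"
      by (auto simp: eq)
    ultimately show "card {l \<in> {..<8}. case x of (j, j', i, i') \<Rightarrow> l \<noteq> i \<and> l \<noteq> i'} = 6"
      by (simp add: card_Diff_subset)
  qed
  also have "4 * int (\<Sum>x\<in>X {..<8}. 6) \<le> 4 * int (6 * card (crossings (complete_bipartite 8 n) D))"
    using card_drawing_quadruples_le[OF assms] by (simp add: X_def)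
  finally show ?thesis by simp
qed

section \<open>A drawing with few crossings\<close>

text \<open>As a graph over the spine the arc has height \<open>s * ((X - x) * (y - X))\<close>,
  whose leading coefficient does not depend on the ends. Two different arcs on one page thus differ
  by a linear function and meet at most once.\<close>

definition parabola :: "real \<Rightarrow> real \<Rightarrow> real \<Rightarrow> real \<Rightarrow> real ^ 2" where
  "parabola s x y t = (\<chi> k. if k = 1 then x + t * (y - x) else s * (t * (1 - t) * (y - x)\<^sup>2))"

lemma parabola_1: "parabola s x y t $ 1 = x + t * (y - x)"
  by (simp add: parabola_def)

lemma parabola_2: "parabola s x y t $ 2 = s * ((parabola s x y t $ 1 - x) * (y - parabola s x y t $ 1))"
  by (simp add: parabola_def power2_eq_square algebra_simps)

lemma strictly_between:
  fixes x y t :: real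
  assumes "0 < t" "t < 1" "x < y"
  shows "x < x + t * (y - x)" "x + t * (y - x) < y"
proof -
  show "x < x + t * (y - x)" using assms by simp
  have "t * (y - x) < 1 * (y - x)" using assms by (intro mult_strict_right_mono) auto
  then show "x + t * (y - x) < y" by (simp only: mult_1_left less_diff_eq add.commute[of x])
qed

lemma arc_parabola:
  assumes "x \<noteq> y"
  shows "arc (parabola s x y)"
  unfolding arc_def path_def
proof
  show "continuous_on {0..1} (parabola s x y)"
    unfolding parabola_def
  proof (rule continuous_on_vec_lambda)
    show "continuous_on {0..1} (\<lambda>t. if k = 1 then x + t * (y - x) else s * (t * (1 - t) * (y - x)\<^sup>2))" for k :: 2
      by (cases "k = 1") (auto intro!: continuous_intros)
  qed
  show "inj_on (parabola s x y) {0..1}"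
  proof (rule inj_onI)
    fix t u assume "parabola s x y t = parabola s x y u"
    then have "x + t * (y - x) = x + u * (y - x)" by (metis parabola_1)
    then show "t = u" using assms by simp
  qed
qed

text \<open>If one interval contained the other, the outer one would have the larger product at X;
  so they interlace. Both ends then move the same way, hence the sums of the ends differ, which is
  the nonvanishing of the denominator in \<open>crossing_point\<close>.\<close>

lemma between_chords_cross:
  fixes X :: real
  assumes "min x y < X" "X < max x y" "min u v < X" "X < max u v"
    and eq: "(X - x) * (y - X) = (X - u) * (v - X)"
    and ne: "{x, y} \<noteq> {u, v}"
  shows "chords_cross x y u v" "x + y \<noteq> u + v"
proof -
  define a b c e where "a = min x y" and "b = max x y" and "c = min u v" and "e = max u v"
  have less: "b < e" if "a < c" "a < X" "X < b" "c < X" "X < e" "(X - a) * (b - X) = (X - c) * (e - X)"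
    for a b c e :: real
  proof (rule ccontr)
    assume "\<not> b < e"
    then have "(X - c) * (e - X) \<le> (X - c) * (b - X)" using that by (intro mult_left_mono) auto
    also have "\<dots> < (X - a) * (b - X)" using that by (intro mult_strict_right_mono) auto
    finally show False using that by simp
  qed
  have mm: "(X - min x y) * (max x y - X) = (X - x) * (y - X)" for x y
    by (cases "x \<le> y") (simp_all add: min_def max_def mult.commute algebra_simps)
  have eq': "(X - a) * (b - X) = (X - c) * (e - X)"
    using eq by (simp add: a_def b_def c_def e_def mm)
  have X: "a < X" "X < b" "c < X" "X < e" using assms(1-4) by (simp_all add: a_def b_def c_def e_def)
  have set_mm: "{x, y} = {min x y, max x y}" for x y :: real by (cases "x \<le> y") (simp_all add: min_def max_def insert_commute)
  have "a \<noteq> c"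
  proof
    assume "a = c"
    moreover from this have "b = e" using eq' X by simp
    ultimately show False using ne set_mm[of x y] set_mm[of u v] by (simp add: a_def b_def c_def e_def)
  qed
  then have "a < c \<and> b < e \<or> c < a \<and> e < b"
    using less[of a c b e] less[of c a e b] X eq' by linarith
  then show "chords_cross x y u v"
    using X unfolding chords_cross_def a_def[symmetric] b_def[symmetric] c_def[symmetric] e_def[symmetric]
    by linarith
  have "min x y + max x y = x + y" for x y :: real by (simp add: min_def max_def)
  then have "a + b = x + y" "c + e = u + v" by (simp_all add: a_def b_def c_def e_def)
  then show "x + y \<noteq> u + v" using \<open>a < c \<and> b < e \<or> c < a \<and> e < b\<close> by linarith
qed

lemma chords_crossD:
  assumes "chords_cross x y u v"
  shows "x < y \<Longrightarrow> u < v \<Longrightarrow> x < u \<and> u < y \<and> y < v \<or> u < x \<and> x < v \<and> v < y"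
    and "x < y \<Longrightarrow> v < u \<Longrightarrow> x < v \<and> v < y \<and> y < u \<or> v < x \<and> x < u \<and> u < y"
    and "y < x \<Longrightarrow> u < v \<Longrightarrow> y < u \<and> u < x \<and> x < v \<or> u < y \<and> y < v \<and> v < x"
    and "y < x \<Longrightarrow> v < u \<Longrightarrow> y < v \<and> v < x \<and> x < u \<or> v < y \<and> y < u \<and> u < x"
  using assms by (simp_all add: chords_cross_def)

text \<open>The linear facts about the positions in \<open>layout\<close>. From left to right: one
  red group below 0, the first blue arc in (0, 8], the other red group in [10, N + 10), the second
  blue arc from N + 20 on.\<close>

definition layout_type :: "bool \<Rightarrow> bool \<Rightarrow> real \<Rightarrow> real \<Rightarrow> real \<Rightarrow> real \<Rightarrow> real \<Rightarrow> bool" where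
  "layout_type left first N I J x y \<longleftrightarrow>
     (if left then x = J - N \<and> x < 0 else x = J + 10 \<and> 10 \<le> x \<and> x < N + 10) \<and>
     (if first then y = I + 1 \<and> 0 < y \<and> y \<le> 8 else y = N + 20 + I \<and> N + 20 \<le> y)"

text \<open>Each page carries two of the four kinds of edges. On one page the kinds span disjoint
  intervals, on the other page every interval of one kind contains all those of the other; so only
  edges of the same kind cross, and these only if their red and blue ends come in the same
  order.\<close>

lemma layout_type_cross:
  assumes "layout_type left first N I J x y" "layout_type left' first' N I' J' u v" "0 \<le> N"
    and "(first = left) = (first' = left')" "chords_cross x y u v"
  shows "left = left' \<and> first = first' \<and> (J < J' \<and> I < I' \<or> J' < J \<and> I' < I)"
proof -
  note cross = chords_crossD[OF assms(5)]
  show ?thesis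
  proof (cases left; cases left'; cases first; cases first')
  qed (use assms(1-4) cross in \<open>simp_all add: layout_type_def\<close>, argo+)
qed

definition layout :: "nat \<Rightarrow> nat \<Rightarrow> nat + nat \<Rightarrow> real" where
  "layout d n v = (case v of
     Inl i \<Rightarrow> if i < d then real i + 1 else real n + 20 + real i
   | Inr j \<Rightarrow> if even j then real j - real n else real j + 10)"

definition page :: "nat \<Rightarrow> nat \<Rightarrow> nat \<Rightarrow> real" where
  "page d i j = (if (i < d) = even j then 1 else - 1)"

text \<open>\<open>curve\<close> receives an edge as a set, so \<open>inv\<close> recovers its two
  indices.\<close>

definition balanced_drawing :: "nat \<Rightarrow> nat \<Rightarrow> (nat + nat) spine_drawing" where
  "balanced_drawing d n =
     \<lparr>normal = axis 2 1, offset = 0,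
      pos = (\<lambda>v. \<chi> k. if k = 1 then layout d n v else 0),
      curve = (\<lambda>e. case inv (\<lambda>(i, j). edge i j) e of
        (i, j) \<Rightarrow> parabola (page d i j) (layout d n (Inl i)) (layout d n (Inr j)))\<rparr>"

lemma balanced_drawing_simps [simp]:
  "normal (balanced_drawing d n) = axis 2 1"
  "offset (balanced_drawing d n) = 0"
  "pos (balanced_drawing d n) v = (\<chi> k. if k = 1 then layout d n v else 0)"
  "curve (balanced_drawing d n) (edge i j) =
     parabola (page d i j) (layout d n (Inl i)) (layout d n (Inr j))"
proof -
  have "inj (\<lambda>(i, j). edge i j)" by (auto simp: inj_on_def)
  then have "inv (\<lambda>(i, j). edge i j) (edge i j) = (i, j)"
    by (metis (mono_tags, lifting) case_prod_conv inv_f_f)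
  then show "curve (balanced_drawing d n) (edge i j) =
     parabola (page d i j) (layout d n (Inl i)) (layout d n (Inr j))"
    by (simp add: balanced_drawing_def)
qed (simp_all add: balanced_drawing_def)

context
  fixes d m n :: nat
  assumes d: "d \<le> 8"
begin

lemma layout_inj:
  assumes "v \<in> vertices (complete_bipartite m n)" "w \<in> vertices (complete_bipartite m n)"
    "layout d n v = layout d n w"
  shows "v = w"
proof -
  have A: "real i + 1 \<le> 8" if "i < d" for i using that d by linarith
  have I: "layout d n (Inl i) \<noteq> layout d n (Inl i')" if "i \<noteq> i'" for i i'
    using that A[of i] A[of i'] by (auto simp: layout_def)
  have J: "layout d n (Inr j) \<noteq> layout d n (Inr j')" if "j \<noteq> j'" "j < n" "j' < n" for j j'
    using that by (auto simp: layout_def)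
  have IJ: "layout d n (Inl i) \<noteq> layout d n (Inr j)" if "j < n" for i j
    using that A[of i] by (auto simp: layout_def)
  show ?thesis
    using assms I J IJ by (cases v; cases w) (auto simp: vertices_complete_bipartite, metis+)
qed

lemma balanced_drawing_valid: "two_page_drawing (complete_bipartite m n) (balanced_drawing d n)"
  unfolding two_page_drawing_def
proof (intro conjI ballI)
  show "normal (balanced_drawing d n) \<noteq> 0" by (simp add: axis_eq_0_iff)
  show "inj_on (pos (balanced_drawing d n)) (vertices (complete_bipartite m n))"
  proof (rule inj_onI)
    fix v w assume vw: "v \<in> vertices (complete_bipartite m n)" "w \<in> vertices (complete_bipartite m n)"
      "pos (balanced_drawing d n) v = pos (balanced_drawing d n) w"
    then have "pos (balanced_drawing d n) v $ 1 = pos (balanced_drawing d n) w $ 1" by simp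
    then have "layout d n v = layout d n w" by simp
    then show "v = w" using layout_inj vw by blast
  qed
  show "pos (balanced_drawing d n) ` vertices (complete_bipartite m n) \<subseteq> spine (balanced_drawing d n)"
    by (auto simp: spine_def inner_axis')
  fix e assume "e \<in> edges (complete_bipartite m n)"
  then obtain i j where e: "e = edge i j" "i < m" "j < n" by (auto simp: edges_complete_bipartite)
  have ne: "layout d n (Inl i) \<noteq> layout d n (Inr j)"
    using layout_inj[of "Inl i" "Inr j"] e by (auto simp: vertices_complete_bipartite)
  show "arc (curve (balanced_drawing d n) e)" using ne by (simp add: e arc_parabola)
  have image: "pos (balanced_drawing d n) ` e =
      {pos (balanced_drawing d n) (Inl i), pos (balanced_drawing d n) (Inr j)}"
    unfolding e(1) edge_def by (simp only: image_insert image_empty)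
  show "{pathstart (curve (balanced_drawing d n) e), pathfinish (curve (balanced_drawing d n) e)} =
      pos (balanced_drawing d n) ` e"
    unfolding image by (simp add: e pathstart_def pathfinish_def parabola_def cong: if_cong)
  have side: "normal (balanced_drawing d n) \<bullet> curve (balanced_drawing d n) e t = page d i j * (t * (1 - t) * (layout d n (Inr j) - layout d n (Inl i))\<^sup>2)" for t
    by (simp add: e inner_axis' parabola_def)
  have pos: "0 < t * (1 - t) * (layout d n (Inr j) - layout d n (Inl i))\<^sup>2" if "t \<in> {0<..<1}" for t
    using that ne by simp
  consider "page d i j = 1" | "page d i j = - 1" by (meson page_def)
  then show "curve (balanced_drawing d n) e ` {0<..<1} \<subseteq> lower_page (balanced_drawing d n) \<or>
      curve (balanced_drawing d n) e ` {0<..<1} \<subseteq> upper_page (balanced_drawing d n)"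
  proof cases
    case 1
    then have "curve (balanced_drawing d n) e ` {0<..<1} \<subseteq> upper_page (balanced_drawing d n)"
      unfolding upper_page_def image_subset_iff mem_Collect_eq side using pos by simp
    then show ?thesis ..
  next
    case 2
    then have "curve (balanced_drawing d n) e ` {0<..<1} \<subseteq> lower_page (balanced_drawing d n)"
      unfolding lower_page_def image_subset_iff mem_Collect_eq side using pos by simp
    then show ?thesis ..
  qed
qed

lemma edge_point:
  assumes "i < m" "j < n" "z \<in> path_image (curve (balanced_drawing d n) (edge i j))"
    and "z \<notin> pos (balanced_drawing d n) ` vertices (complete_bipartite m n)"
  shows "min (layout d n (Inr j)) (layout d n (Inl i)) < z $ 1"
    "z $ 1 < max (layout d n (Inr j)) (layout d n (Inl i))"
    "z $ 2 = page d i j * ((z $ 1 - layout d n (Inr j)) * (layout d n (Inl i) - z $ 1))"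
    "0 < page d i j * z $ 2"
proof -
  let ?x = "layout d n (Inl i)" and ?y = "layout d n (Inr j)"
  obtain t where t: "t \<in> {0..1}" "z = parabola (page d i j) ?x ?y t"
    using assms(3) by (auto simp: path_image_def)
  have "pos (balanced_drawing d n) (Inl i) \<noteq> z" "pos (balanced_drawing d n) (Inr j) \<noteq> z"
    using assms(1,2,4) vertices_complete_bipartite by blast+
  then have "t \<noteq> 0" "t \<noteq> 1" unfolding t(2) by (auto simp: parabola_def cong: if_cong)
  then have t01: "0 < t" "t < 1" using t(1) by auto
  have z1: "z $ 1 = ?x + t * (?y - ?x)" by (simp add: t(2) parabola_1)
  have "?x \<noteq> ?y" using layout_inj[of "Inl i" "Inr j"] assms by (auto simp: vertices_complete_bipartite)
  then consider "?x < ?y" | "?y < ?x" by linarith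
  then have "min ?y ?x < z $ 1 \<and> z $ 1 < max ?y ?x"
  proof cases
    case 1
    then show ?thesis using strictly_between[OF t01 1] z1 by simp
  next
    case 2
    have "z $ 1 = ?y + (1 - t) * (?x - ?y)" by (simp add: z1 algebra_simps)
    then show ?thesis using strictly_between[of "1 - t" ?y ?x] 2 t01 by simp
  qed
  then show "min ?y ?x < z $ 1" "z $ 1 < max ?y ?x" by auto
  show "z $ 2 = page d i j * ((z $ 1 - ?y) * (?x - z $ 1))"
    using parabola_2[of "page d i j" ?x ?y t] by (simp add: t(2) algebra_simps)
  show "0 < page d i j * z $ 2"
  proof -
    have "page d i j * z $ 2 = t * (1 - t) * (?y - ?x)\<^sup>2" by (simp add: t(2) parabola_def page_def)
    then show ?thesis using t01 \<open>?x \<noteq> ?y\<close> by simp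
  qed
qed

text \<open>Solution of the linear equation left after the squares of the abscissa cancel. As it
  depends on the two edges only, a pair of edges contributes at most one crossing.\<close>

definition crossing_point :: "nat \<Rightarrow> nat \<Rightarrow> nat \<Rightarrow> nat \<Rightarrow> real ^ 2" where
  "crossing_point i j i' j' =
     (let x = layout d n (Inr j); y = layout d n (Inl i); u = layout d n (Inr j'); v = layout d n (Inl i');
          X = (x * y - u * v) / (x + y - (u + v))
      in \<chi> k. if k = 1 then X else page d i j * ((X - x) * (y - X)))"

lemma crossing_location:
  assumes "i < m" "j < n" "i' < m" "j' < n" "edge i j \<noteq> edge i' j'"
    and z: "z \<in> path_image (curve (balanced_drawing d n) (edge i j))"
      "z \<in> path_image (curve (balanced_drawing d n) (edge i' j'))"
      "z \<notin> pos (balanced_drawing d n) ` vertices (complete_bipartite m n)"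
  shows "even (j + j')" "(i < d) = (i' < d)" "j < j' \<and> i < i' \<or> j' < j \<and> i' < i" "z = crossing_point i j i' j'"
proof -
  let ?x = "layout d n (Inr j)" and ?y = "layout d n (Inl i)"
    and ?u = "layout d n (Inr j')" and ?v = "layout d n (Inl i')"
  note p = edge_point[OF assms(1,2) z(1,3)] and q = edge_point[OF assms(3,4) z(2,3)]
  \<comment> \<open>The height of a common point has the sign of the page of either edge.\<close>
  have same: "page d i j = page d i' j'"
    using p(4) q(4) by (auto simp: page_def split: if_splits)
  have nz: "page d i j \<noteq> 0" by (simp add: page_def)
  have eq: "(z $ 1 - ?x) * (?y - z $ 1) = (z $ 1 - ?u) * (?v - z $ 1)"
    using p(3) q(3) same nz by simp
  have ne: "{?x, ?y} \<noteq> {?u, ?v}"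
  proof
    assume "{?x, ?y} = {?u, ?v}"
    moreover have "?x \<noteq> ?v" using layout_inj[of "Inr j" "Inl i'"] assms
      by (auto simp: vertices_complete_bipartite)
    ultimately have "?x = ?u" "?y = ?v" by (auto simp: doubleton_eq_iff)
    then have "j = j'" "i = i'"
      using layout_inj[of "Inr j" "Inr j'"] layout_inj[of "Inl i" "Inl i'"] assms
      by (auto simp: vertices_complete_bipartite)
    then show False using assms(5) by simp
  qed
  note cross = between_chords_cross[OF p(1,2) q(1,2) eq ne]
  have type: "layout_type (even j) (i < d) (real n) (real i) (real j) (layout d n (Inr j)) (layout d n (Inl i))"
    if "j < n" for i j
    using that d by (auto simp: layout_type_def layout_def)
  have "even j = even j' \<and> (i < d) = (i' < d) \<and> (real j < real j' \<and> real i < real i' \<or> real j' < real j \<and> real i' < real i)"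
  proof (rule layout_type_cross[OF type[OF assms(2)] type[OF assms(4)] _ _ cross(1)])
    show "((i < d) = even j) = ((i' < d) = even j')" using same by (auto simp: page_def split: if_splits)
  qed simp
  then show "even (j + j')" "(i < d) = (i' < d)" "j < j' \<and> i < i' \<or> j' < j \<and> i' < i" by auto
  have "z $ 1 * (?x + ?y - (?u + ?v)) = ?x * ?y - ?u * ?v"
    using eq by (simp add: algebra_simps)
  then have "z $ 1 = (?x * ?y - ?u * ?v) / (?x + ?y - (?u + ?v))"
    using cross(2) by (simp add: field_simps)
  then show "z = crossing_point i j i' j'"
    using p(3) by (simp add: crossing_point_def Let_def vec_eq_iff forall_2)
qed

lemma crossings_balanced_drawing:
  "crossings (complete_bipartite m n) (balanced_drawing d n) \<subseteq>
     (\<lambda>((j, j'), (i, i')). ({edge i j, edge i' j'}, crossing_point i j i' j')) `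
       ({(j, j'). j < j' \<and> j' < n \<and> even (j + j')} \<times> {(i, i'). i < i' \<and> i' < m \<and> (i < d) = (i' < d)})"
proof
  fix w assume "w \<in> crossings (complete_bipartite m n) (balanced_drawing d n)"
  then obtain i j i' j' z where w: "w = ({edge i j, edge i' j'}, z)" "i < m" "j < n" "i' < m" "j' < n"
    "edge i j \<noteq> edge i' j'" "z \<in> path_image (curve (balanced_drawing d n) (edge i j))"
    "z \<in> path_image (curve (balanced_drawing d n) (edge i' j'))"
    "z \<notin> pos (balanced_drawing d n) ` vertices (complete_bipartite m n)"
    unfolding crossings_def edges_complete_bipartite by blast
  note 1 = crossing_location[OF w(2-9)]
  \<comment> \<open>The same point computed from the exchanged edges, for the case in which the pair
    is listed in the other order.\<close>
  have "edge i' j' \<noteq> edge i j" using w(6) by metis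
  then have 2: "z = crossing_point i' j' i j"
    by (rule crossing_location(4)[OF w(4,5,2,3) _ w(8,7,9)])
  from 1(3) show "w \<in> (\<lambda>((j, j'), (i, i')). ({edge i j, edge i' j'}, crossing_point i j i' j')) `
       ({(j, j'). j < j' \<and> j' < n \<and> even (j + j')} \<times> {(i, i'). i < i' \<and> i' < m \<and> (i < d) = (i' < d)})"
  proof (elim disjE conjE)
    assume "j < j'" "i < i'"
    then show ?thesis using 1 w by (intro image_eqI[of _ _ "((j, j'), (i, i'))"]) auto
  next
    assume "j' < j" "i' < i"
    then show ?thesis using 1 2 w
      by (intro image_eqI[of _ _ "((j', j), (i', i))"]) (auto simp: insert_commute add.commute)
  qed
qed

end

section \<open>Counting pairs in one red group and pairs in one blue arc\<close>

lemma card_same_parity_below: "2 * card {j. j < n \<and> even (j + n)} \<le> n"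
proof (induction n rule: induct_nat_012)
  case (ge2 n)
  have "{j. j < Suc (Suc n) \<and> even (j + Suc (Suc n))} = insert n {j. j < n \<and> even (j + n)}"
    by (auto simp: less_Suc_eq)
  then show ?case using ge2(1) by simp
next
  case 1
  have "{j. j < Suc 0 \<and> even (j + Suc 0)} = ({} :: nat set)" by (auto intro: odd_pos)
  then have "card {j. j < Suc 0 \<and> even (j + Suc 0)} = 0" by (simp only: card.empty)
  then show ?case by linarith
qed auto

text \<open>At most n/2 pairs have larger element n, and four times that stays below (n + 1)^2 -
  n^2.\<close>

lemma card_same_parity_pairs: "4 * card {(j, j'). j < j' \<and> j' < n \<and> even (j + j')} \<le> n\<^sup>2"
proof (induction n)
  case (Suc n)
  let ?P = "\<lambda>n. {(j, j'). j < j' \<and> j' < n \<and> even (j + j' :: nat)}" and ?S = "{j. j < n \<and> even (j + n)}"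
  have "?P (Suc n) = ?P n \<union> (\<lambda>j. (j, n)) ` ?S"
    by (auto simp: less_Suc_eq image_iff)
  moreover have "card ((\<lambda>j. (j, n)) ` ?S) = card ?S"
    by (intro card_image) (auto simp: inj_on_def)
  ultimately have "card (?P (Suc n)) \<le> card (?P n) + card ?S"
    using card_Un_le[of "?P n" "(\<lambda>j. (j, n)) ` ?S"] by simp
  then show ?case using Suc.IH card_same_parity_below[of n] by (simp add: power2_eq_square)
qed simp

lemma balanced_drawing_crossings_le:
  fixes C :: nat
  assumes "d \<le> 8" and C: "card {(i, i'). i < i' \<and> i' < m \<and> (i < d) = (i' < d)} \<le> C"
  shows "finite (crossings (complete_bipartite m n) (balanced_drawing d n))"
    and "4 * card (crossings (complete_bipartite m n) (balanced_drawing d n)) \<le> C * n\<^sup>2"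
proof -
  let ?P = "{(j, j'). j < j' \<and> j' < n \<and> even (j + j')}"
    and ?Q = "{(i, i'). i < i' \<and> i' < m \<and> (i < d) = (i' < d)}"
  have fin: "finite ?P" "finite ?Q"
    by (rule finite_subset[of _ "{..<n} \<times> {..<n}"], auto)
      (rule finite_subset[of _ "{..<m} \<times> {..<m}"], auto)
  then have fin': "finite (?P \<times> ?Q)" by simp
  note sub = crossings_balanced_drawing[OF assms(1), of m n]
  show "finite (crossings (complete_bipartite m n) (balanced_drawing d n))"
    by (rule finite_subset[OF sub]) (use fin' in simp)
  have "card (crossings (complete_bipartite m n) (balanced_drawing d n)) \<le> card (?P \<times> ?Q)"
    using fin' by (intro surj_card_le[OF _ sub])
  then have "4 * card (crossings (complete_bipartite m n) (balanced_drawing d n)) \<le> 4 * card ?P * card ?Q"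
    by (simp add: card_cartesian_product)
  also have "\<dots> \<le> 4 * card ?P * C" using C by (rule mult_left_mono) simp
  also have "\<dots> \<le> n\<^sup>2 * C" by (intro mult_right_mono card_same_parity_pairs) simp
  finally show "4 * card (crossings (complete_bipartite m n) (balanced_drawing d n)) \<le> C * n\<^sup>2"
    by (simp add: mult.commute)
qed

text \<open>9 = 3 + 6 from arcs of 3 and 4 vertices, 12 = 6 + 6 from two arcs of 4.\<close>

lemma same_arc_pairs:
  "card {(i, i'). i < i' \<and> i' < 7 \<and> (i < 3) = (i' < (3::nat))} \<le> 9"
  "card {(i, i'). i < i' \<and> i' < 8 \<and> (i < 4) = (i' < (4::nat))} \<le> 12"
proof -
  have bound: "card {(i, i'). i < i' \<and> i' < m \<and> (i < d) = (i' < d)} \<le>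
      length (filter (\<lambda>(i, i'). i < i' \<and> (i < d) = (i' < d)) (List.product [0..<m] [0..<m]))" for m d :: nat
    by (rule order_trans[OF card_mono card_length]) (unfold set_filter List.set_product set_upt, auto)
  show "card {(i, i'). i < i' \<and> i' < 7 \<and> (i < 3) = (i' < (3::nat))} \<le> 9"
    by (rule order_trans[OF bound]) code_simp
  show "card {(i, i'). i < i' \<and> i' < 8 \<and> (i < 4) = (i' < (4::nat))} \<le> 12"
    by (rule order_trans[OF bound]) code_simp
qed

section \<open>Asymptotics\<close>

lemma two_page_crossing_number_le:
  assumes "two_page_drawing G D" "finite (crossings G D)"
  shows "\<nu>\<^sub>2 G \<le> card (crossings G D)"
  unfolding two_page_crossing_number_def using assms by (intro Least_le) blast

text \<open>\<open>LEAST\<close> is meaningful once some drawing with finitely many crossings is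
  known; the balanced drawing will supply it.\<close>

lemma two_page_crossing_number_attained:
  assumes "two_page_drawing G D" "finite (crossings G D)"
  obtains D' where "two_page_drawing G D'" "finite (crossings G D')" "card (crossings G D') = \<nu>\<^sub>2 G"
proof -
  have "\<exists>k D. two_page_drawing G D \<and> finite (crossings G D) \<and> card (crossings G D) = k"
    using assms by blast
  from LeastI_ex[OF this] show ?thesis
    unfolding two_page_crossing_number_def[symmetric] using that by blast
qed

lemma crossing_number_7:
  "9 * (real n)\<^sup>2 - 98 * real n \<le> 4 * real (\<nu>\<^sub>2 (complete_bipartite 7 n))"
  "4 * real (\<nu>\<^sub>2 (complete_bipartite 7 n)) \<le> 9 * (real n)\<^sup>2"
proof -
  let ?D = "balanced_drawing 3 n" and ?G = "complete_bipartite 7 n"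
  have D: "two_page_drawing ?G ?D" by (intro balanced_drawing_valid) simp
  have "finite (crossings ?G ?D)" "4 * card (crossings ?G ?D) \<le> 9 * n\<^sup>2"
    using same_arc_pairs(1) by (intro balanced_drawing_crossings_le; simp)+
  note fin = this
  have "4 * \<nu>\<^sub>2 ?G \<le> 9 * n\<^sup>2"
    using two_page_crossing_number_le[OF D fin(1)] fin(2) by linarith
  then have "real (4 * \<nu>\<^sub>2 ?G) \<le> real (9 * n\<^sup>2)" by (rule of_nat_mono)
  then show "4 * real (\<nu>\<^sub>2 ?G) \<le> 9 * (real n)\<^sup>2" by simp
  obtain D' where D': "two_page_drawing ?G D'" "finite (crossings ?G D')" "card (crossings ?G D') = \<nu>\<^sub>2 ?G"
    using two_page_crossing_number_attained[OF D fin(1)] .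
  have "9 * (int n)\<^sup>2 - 98 * int n \<le> 4 * int (\<nu>\<^sub>2 ?G)"
    using crossings_ge_7[OF D'(1,2)] D'(3) by simp
  then have "real_of_int (9 * (int n)\<^sup>2 - 98 * int n) \<le> real_of_int (4 * int (\<nu>\<^sub>2 ?G))"
    by (rule of_int_le_iff[THEN iffD2])
  then show "9 * (real n)\<^sup>2 - 98 * real n \<le> 4 * real (\<nu>\<^sub>2 ?G)" by simp
qed

lemma crossing_number_8:
  "36 * (real n)\<^sup>2 - 392 * real n \<le> 12 * real (\<nu>\<^sub>2 (complete_bipartite 8 n))"
  "4 * real (\<nu>\<^sub>2 (complete_bipartite 8 n)) \<le> 12 * (real n)\<^sup>2"
proof -
  let ?D = "balanced_drawing 4 n" and ?G = "complete_bipartite 8 n"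
  have D: "two_page_drawing ?G ?D" by (intro balanced_drawing_valid) simp
  have "finite (crossings ?G ?D)" "4 * card (crossings ?G ?D) \<le> 12 * n\<^sup>2"
    using same_arc_pairs(2) by (intro balanced_drawing_crossings_le; simp)+
  note fin = this
  have "4 * \<nu>\<^sub>2 ?G \<le> 12 * n\<^sup>2"
    using two_page_crossing_number_le[OF D fin(1)] fin(2) by linarith
  then have "real (4 * \<nu>\<^sub>2 ?G) \<le> real (12 * n\<^sup>2)" by (rule of_nat_mono)
  then show "4 * real (\<nu>\<^sub>2 ?G) \<le> 12 * (real n)\<^sup>2" by simp
  obtain D' where D': "two_page_drawing ?G D'" "finite (crossings ?G D')" "card (crossings ?G D') = \<nu>\<^sub>2 ?G"
    using two_page_crossing_number_attained[OF D fin(1)] .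
  have "36 * (int n)\<^sup>2 - 392 * int n \<le> 12 * int (\<nu>\<^sub>2 ?G)"
    using crossings_ge_8[OF D'(1,2)] D'(3) by simp
  then have "real_of_int (36 * (int n)\<^sup>2 - 392 * int n) \<le> real_of_int (12 * int (\<nu>\<^sub>2 ?G))"
    by (rule of_int_le_iff[THEN iffD2])
  then show "36 * (real n)\<^sup>2 - 392 * real n \<le> 12 * real (\<nu>\<^sub>2 ?G)" by simp
qed

text \<open>The lower bound is (n/2 - 1) ((n - 1)/2 - 1) = n^2/4 - 5/4 n + 3/2; both factors are
  nonnegative from n = 3 on.\<close>

lemma floor_halves_bounds:
  assumes "3 \<le> n"
  shows "real_of_int (\<lfloor>real n / 2\<rfloor> * \<lfloor>(real n - 1) / 2\<rfloor>) \<le> (real n)\<^sup>2 / 4"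
    and "(real n)\<^sup>2 / 4 - 5 / 4 * real n \<le> real_of_int (\<lfloor>real n / 2\<rfloor> * \<lfloor>(real n - 1) / 2\<rfloor>)"
proof -
  define u v where "u = real_of_int \<lfloor>real n / 2\<rfloor>" and "v = real_of_int \<lfloor>(real n - 1) / 2\<rfloor>"
  have uv: "real n / 2 - 1 \<le> u" "u \<le> real n / 2" "(real n - 1) / 2 - 1 \<le> v" "v \<le> (real n - 1) / 2"
    unfolding u_def v_def by linarith+
  have n: "3 \<le> real n" using assms by simp
  have nonneg: "0 \<le> v" "0 \<le> real n / 2" "v \<le> real n / 2" "0 \<le> u" "0 \<le> real n / 2 - 1" "0 \<le> (real n - 1) / 2 - 1"
    using uv n by (auto simp: field_simps)
  have "u * v \<le> (real n / 2) * (real n / 2)" using uv nonneg by (intro mult_mono)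
  then show "real_of_int (\<lfloor>real n / 2\<rfloor> * \<lfloor>(real n - 1) / 2\<rfloor>) \<le> (real n)\<^sup>2 / 4"
    by (simp add: u_def v_def power2_eq_square)
  have "(real n / 2 - 1) * ((real n - 1) / 2 - 1) \<le> u * v" using uv nonneg by (intro mult_mono)
  moreover have "(real n)\<^sup>2 / 4 - 5 / 4 * real n \<le> (real n / 2 - 1) * ((real n - 1) / 2 - 1)"
    by (simp add: power2_eq_square field_simps)
  ultimately show "(real n)\<^sup>2 / 4 - 5 / 4 * real n \<le> real_of_int (\<lfloor>real n / 2\<rfloor> * \<lfloor>(real n - 1) / 2\<rfloor>)"
    by (simp add: u_def v_def)
qed

lemma Z_7: "real_of_int (Z 7 n) = 9 * real_of_int (\<lfloor>real n / 2\<rfloor> * \<lfloor>(real n - 1) / 2\<rfloor>)"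
proof -
  have "\<lfloor>real 7 / 2\<rfloor> = 3" "\<lfloor>(real 7 - 1) / 2\<rfloor> = 3" by (simp_all add: floor_eq_iff)
  then show ?thesis by (simp add: Z_def)
qed

lemma Z_8: "real_of_int (Z 8 n) = 12 * real_of_int (\<lfloor>real n / 2\<rfloor> * \<lfloor>(real n - 1) / 2\<rfloor>)"
proof -
  have "\<lfloor>real 8 / 2\<rfloor> = 4" "\<lfloor>(real 8 - 1) / 2\<rfloor> = 3" by (simp_all add: floor_eq_iff)
  then show ?thesis by (simp add: Z_def)
qed

lemma bigo_linearI:
  fixes f :: "nat \<Rightarrow> real"
  assumes "\<And>n. n \<ge> 3 \<Longrightarrow> \<bar>f n\<bar> \<le> c * real n"
  shows "f \<in> O[at_top](\<lambda>n. real n)"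
  using assms by (intro bigoI[of _ c] eventually_at_top_linorderI[of 3]) simp

lemma ratio_tendsto_1:
  fixes f g :: "nat \<Rightarrow> real"
  assumes diff: "\<And>n. n \<ge> 3 \<Longrightarrow> \<bar>f n - g n\<bar> \<le> c * real n"
    and quad: "\<And>n. n \<ge> 3 \<Longrightarrow> a * (real n)\<^sup>2 - b * real n \<le> g n" and "a > 0"
  shows "(\<lambda>n. f n / g n) \<longlonglongrightarrow> 1"
proof (rule LIM_zero_cancel, rule Lim_null_comparison)
  \<comment> \<open>Beyond 2 b / a the linear term takes away at most half of
    \<open>a * (real n)^2\<close>.\<close>
  have "eventually (\<lambda>n. max 3 (nat \<lceil>2 * b / a\<rceil>) \<le> n) sequentially"
    by (rule eventually_ge_at_top)
  then have "eventually (\<lambda>n. 2 * b / a \<le> real n \<and> 3 \<le> n) sequentially"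
    by eventually_elim (simp add: nat_ceiling_le_eq)
  then show "eventually (\<lambda>n. norm (f n / g n - 1) \<le> (2 * c / a) / real n) sequentially"
  proof eventually_elim
    case (elim n)
    then have n: "real n > 0" by simp
    have "b * real n \<le> a / 2 * (real n)\<^sup>2"
    proof -
      have "b \<le> a / 2 * real n" using elim \<open>a > 0\<close> by (simp add: field_simps)
      then show ?thesis using n by (simp add: power2_eq_square mult_right_mono)
    qed
    then have g: "a / 2 * (real n)\<^sup>2 \<le> g n" using quad[of n] elim by simp
    have pos: "0 < a / 2 * (real n)\<^sup>2" using n \<open>a > 0\<close> by simp
    have "norm (f n / g n - 1) = \<bar>f n - g n\<bar> / g n"
      using g pos by (simp add: divide_simps abs_div)
    also have "\<dots> \<le> (c * real n) / (a / 2 * (real n)\<^sup>2)"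
      using diff[of n] elim g pos by (intro frac_le) auto
    also have "\<dots> = (2 * c / a) / real n"
      using n \<open>a > 0\<close> by (simp add: power2_eq_square field_simps)
    finally show ?case .
  qed
  show "(\<lambda>n. (2 * c / a) / real n) \<longlonglongrightarrow> 0" by (rule lim_const_over_n)
qed

theorem theorem2:
  shows "((\<lambda>n. real (\<nu>\<^sub>2 (complete_bipartite 7 n)) - 9 / 4 * real n ^ 2) \<in> O[at_top](\<lambda>n. real n))
    \<and> ((\<lambda>n. real (\<nu>\<^sub>2 (complete_bipartite 7 n)) - real_of_int (Z 7 n)) \<in> O[at_top](\<lambda>n. real n))
    \<and> ((\<lambda>n. real (\<nu>\<^sub>2 (complete_bipartite 8 n)) - 3 * real n ^ 2) \<in> O[at_top](\<lambda>n. real n))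
    \<and> ((\<lambda>n. real (\<nu>\<^sub>2 (complete_bipartite 8 n)) - real_of_int (Z 8 n)) \<in> O[at_top](\<lambda>n. real n))
    \<and> ((\<lambda>n. real (\<nu>\<^sub>2 (complete_bipartite 7 n)) / real_of_int (Z 7 n)) \<longlonglongrightarrow> 1)
    \<and> ((\<lambda>n. real (\<nu>\<^sub>2 (complete_bipartite 8 n)) / real_of_int (Z 8 n)) \<longlonglongrightarrow> 1)"
proof -
  \<comment> \<open>The errors are 98/4 and 392/12 from the lower bounds, and 45/4 = 9 * 5/4 and 15
    = 12 * 5/4 from \<open>Z\<close>; all are below 50.\<close>
  have bounds: "\<bar>real (\<nu>\<^sub>2 (complete_bipartite 7 n)) - real_of_int (Z 7 n)\<bar> \<le> 50 * real n \<and>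
      \<bar>real (\<nu>\<^sub>2 (complete_bipartite 8 n)) - real_of_int (Z 8 n)\<bar> \<le> 50 * real n \<and>
      9 / 4 * (real n)\<^sup>2 - 45 / 4 * real n \<le> real_of_int (Z 7 n) \<and>
      3 * (real n)\<^sup>2 - 15 * real n \<le> real_of_int (Z 8 n)" if "n \<ge> 3" for n
  proof -
    define F where "F = real_of_int (\<lfloor>real n / 2\<rfloor> * \<lfloor>(real n - 1) / 2\<rfloor>)"
    have "F \<le> (real n)\<^sup>2 / 4" "(real n)\<^sup>2 / 4 - 5 / 4 * real n \<le> F"
      unfolding F_def by (rule floor_halves_bounds[OF that])+
    moreover have "real_of_int (Z 7 n) = 9 * F" "real_of_int (Z 8 n) = 12 * F"
      unfolding F_def by (rule Z_7 Z_8)+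
    moreover have "0 \<le> real n" by simp
    ultimately show ?thesis
      using crossing_number_7[of n] crossing_number_8[of n] unfolding abs_le_iff
      by (intro conjI) linarith+
  qed
  have "\<bar>real (\<nu>\<^sub>2 (complete_bipartite 7 n)) - 9 / 4 * (real n)\<^sup>2\<bar> \<le> 50 * real n"
    "\<bar>real (\<nu>\<^sub>2 (complete_bipartite 8 n)) - 3 * (real n)\<^sup>2\<bar> \<le> 50 * real n" for n
  proof -
    have "0 \<le> real n" by simp
    then show "\<bar>real (\<nu>\<^sub>2 (complete_bipartite 7 n)) - 9 / 4 * (real n)\<^sup>2\<bar> \<le> 50 * real n"
      "\<bar>real (\<nu>\<^sub>2 (complete_bipartite 8 n)) - 3 * (real n)\<^sup>2\<bar> \<le> 50 * real n"
      using crossing_number_7[of n] crossing_number_8[of n] unfolding abs_le_iff by linarith+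
  qed
  note quadratic = this
  show ?thesis
  proof (intro conjI)
    show "(\<lambda>n. real (\<nu>\<^sub>2 (complete_bipartite 7 n)) - 9 / 4 * real n ^ 2) \<in> O[at_top](\<lambda>n. real n)"
      "(\<lambda>n. real (\<nu>\<^sub>2 (complete_bipartite 8 n)) - 3 * real n ^ 2) \<in> O[at_top](\<lambda>n. real n)"
      by (rule bigo_linearI, rule quadratic)+
    show "(\<lambda>n. real (\<nu>\<^sub>2 (complete_bipartite 7 n)) - real_of_int (Z 7 n)) \<in> O[at_top](\<lambda>n. real n)"
      "(\<lambda>n. real (\<nu>\<^sub>2 (complete_bipartite 8 n)) - real_of_int (Z 8 n)) \<in> O[at_top](\<lambda>n. real n)"
      using bounds by (blast intro: bigo_linearI)+
    show "(\<lambda>n. real (\<nu>\<^sub>2 (complete_bipartite 7 n)) / real_of_int (Z 7 n)) \<longlonglongrightarrow> 1"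
      by (rule ratio_tendsto_1[of _ _ 50 "9 / 4" "45 / 4"]) (use bounds in auto)
    show "(\<lambda>n. real (\<nu>\<^sub>2 (complete_bipartite 8 n)) / real_of_int (Z 8 n)) \<longlonglongrightarrow> 1"
      by (rule ratio_tendsto_1[of _ _ 50 3 15]) (use bounds in auto)
  qed
qed

end
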